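(* There is an absolute constant $C>0$ such that, for every $m,n\in\mathbb N$, every $2m\le p<\infty$, and every symmetric complex $m$-linear form $T:(\mathbb C^n)^m\to\mathbb C$, \[ \Bigl(\sum_{i_1,\ldots,i_m=1}^n|T(e_{i_1},\ldots,e_{i_m})|^{\frac{2mp}{mp+p-2m}}\Bigr)^{\frac{mp+p-2m}{2mp}} \le\Bigl(1+\frac Cm\Bigr)\sup_{\|z\|_{\ell_p^n}\le1}|T(z,\ldots,z)|. \] Moreover, there are absolute constants $A>0$ and $m_0\in\mathbb N$ such that, for all integers $m\ge m_0$, all real $p\ge2m+A$, every $n\in\mathbb N$, and every symmetric complex $m$-linear form $T:(\mathbb C^n)^m\to\mathbb C$, the factor $1+C/m$ in this inequality can be replaced by $1$, that is, \[ \Bigl(\sum_{i_1,\ldots,i_m=1}^n|T(e_{i_1},\ldots,e_{i_m})|^{\frac{2mp}{mp+p-2m}}\Bigr)^{\frac{mp+p-2m}{2mp}} \le\sup_{\|z\|_{\ell_p^n}\le1}|T(z,\ldots,z)|. \]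
   Context: $e_1,\ldots,e_n$ is the canonical basis of $\mathbb C^n$; the supremum on the right is over $z\in\mathbb C^n$ with $\ell_p^n$ norm at most $1$. "Absolute constant" means independent of $m,n,p,T$. *)

theory Defs
  imports "HOL-Analysis.Analysis" "HOL-Combinatorics.Permutations" "Jordan_Normal_Form.Matrix"
begin

text \<open>
  The constants in the theorem must not depend on the dimension \<open>n\<close>, so \<open>n\<close> is quantified inside
  the formula: the space of complex \<open>n\<close>-vectors is \<^term>\<open>carrier_vec n\<close> rather than a
  type, and its canonical basis is \<^term>\<open>unit_vec n i\<close> for \<open>i < n\<close> (indices start at 0).
  A map of \<open>m\<close> vector arguments is a function on lists, constrained only on the lists
  in \<open>vec_tuples m n\<close>.
\<close>

definition vec_tuples :: "nat \<Rightarrow> nat \<Rightarrow> complex Matrix.vec list set" where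
  "vec_tuples m n = {vs. length vs = m \<and> set vs \<subseteq> carrier_vec n}"

definition multilinear_form :: "nat \<Rightarrow> nat \<Rightarrow> (complex Matrix.vec list \<Rightarrow> complex) \<Rightarrow> bool" where
  "multilinear_form m n T \<longleftrightarrow>
     (\<forall>vs \<in> vec_tuples m n. \<forall>k < m.
        (\<forall>u \<in> carrier_vec n. \<forall>w \<in> carrier_vec n.
           T (vs[k := u + w]) = T (vs[k := u]) + T (vs[k := w])) \<and>
        (\<forall>c. \<forall>u \<in> carrier_vec n. T (vs[k := c \<cdot>\<^sub>v u]) = c * T (vs[k := u])))"

definition symmetric_form :: "nat \<Rightarrow> nat \<Rightarrow> (complex Matrix.vec list \<Rightarrow> complex) \<Rightarrow> bool" where
  "symmetric_form m n T \<longleftrightarrow>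
     (\<forall>vs \<in> vec_tuples m n. \<forall>\<sigma>. \<sigma> permutes {..<m} \<longrightarrow> T (permute_list \<sigma> vs) = T vs)"

definition lp_norm :: "real \<Rightarrow> complex Matrix.vec \<Rightarrow> real" where
  "lp_norm p z = (\<Sum>i < dim_vec z. cmod (vec_index z i) powr p) powr (1 / p)"

definition index_tuples :: "nat \<Rightarrow> nat \<Rightarrow> nat list set" where
  "index_tuples m n = {is. length is = m \<and> set is \<subseteq> {..<n}}"

text \<open>
  The set below is nonempty and, for a multilinear form and \<open>p > 0\<close>, bounded above (the dimension is
  finite), so the real-valued supremum is the genuine one.
\<close>

definition diag_sup :: "nat \<Rightarrow> nat \<Rightarrow> real \<Rightarrow> (complex Matrix.vec list \<Rightarrow> complex) \<Rightarrow> real" where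
  "diag_sup m n p T =
     (SUP z \<in> {z \<in> carrier_vec n. lp_norm p z \<le> 1}. cmod (T (replicate m z)))"

end

theory Submission
  imports Defs
begin

text \<open>
  Write \<open>P(z) = T(z,\<dots>,z) = \<Sum> c\<^sub>i z\<^sub>i\<close> over index tuples \<open>i\<close>, \<open>M\<close> for its supremum, \<open>s\<close> for the exponent of the
  theorem and \<open>q = p / (p - m)\<close>.  Averaging over \<open>m\<close>-th roots of unity isolates the diagonal,
  so \<open>\<Sum>\<^sub>k |c\<^sub>k\<^sub>\<dots>\<^sub>k|\<^sup>q \<le> M\<^sup>q\<close>, and \<open>s \<ge> q\<close>.  The off-diagonal entries satisfy \<open>\<Sum> |c\<^sub>i|\<^sup>s \<le> (C/m) M\<^sup>s\<close>:
  a Blei-type inequality, proved by entropy, bounds their \<open>s\<close>-norm by \<open>\<Sum>\<^sub>k x\<^sub>k (\<Sum>\<^sub>l |c\<^sub>k\<^sub>l x\<^sub>l|\<^sup>2)\<^sup>1\<^sup>/\<^sup>2\<close> with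
  \<open>x\<close> in the \<open>\<ell>\<^sub>p\<close> ball, which reduces the question to the polydisc.  There the coefficients are grouped by
  the multiplicity \<open>t\<close> of \<open>k\<close>; setting random variables to \<open>0\<close> and using an \<open>L\<^sup>1\<close>--\<open>\<ell>\<^sup>2\<close> inequality
  with a constant independent of the degree bounds group \<open>t\<close> by \<open>C M / (m choose t)\<^sup>1\<^sup>/\<^sup>2\<close>, and
  \<open>\<Sum>\<^sub>0\<^sub><\<^sub>t\<^sub><\<^sub>m (m choose t)\<^sup>-\<^sup>1\<^sup>/\<^sup>2 \<le> 10 / \<surd>m\<close>.  This gives the factor \<open>1 + C/m\<close>.

  For the contractive case let \<open>M = 1\<close> and let \<open>1 - \<delta>\<close> be the largest diagonal modulus, at index \<open>j\<close>.  The
  diagonal contributes at most \<open>(1 - \<delta>)\<^sup>s\<^sup>-\<^sup>q \<le> 1 - (s - q) \<delta>\<close>, where \<open>s - q \<ge> A / (6 m)\<close>.  The coefficient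
  form \<open>P\<^sub>k\<close> of \<open>z\<^sub>j\<^sup>m\<^sup>-\<^sup>k\<close> has norm at most \<open>8 \<delta>\<^sup>1\<^sup>-\<^sup>k\<^sup>/\<^sup>p\<close>, because a power series bounded by \<open>1\<close> satisfies
  \<open>|b\<^sub>0| + |b\<^sub>k|/2 \<le> 1\<close>; applying the first part to every \<open>P\<^sub>k\<close> improves the
  off-diagonal bound to \<open>(C/m) \<delta>\<close>.
\<close>

section \<open>Forms on index tuples\<close>

definition tup :: "nat \<Rightarrow> 'a set \<Rightarrow> 'a list set" where
  "tup m I = {xs. length xs = m \<and> set xs \<subseteq> I}"

text \<open>Rearrangement is expressed by equality of multisets, so no permutation has to be named
  when copies of an index are moved to the front of a tuple.\<close>

definition symm_on :: "nat \<Rightarrow> 'a set \<Rightarrow> ('a list \<Rightarrow> 'b) \<Rightarrow> bool" where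
  "symm_on m I F \<longleftrightarrow> (\<forall>xs \<in> tup m I. \<forall>ys. mset xs = mset ys \<longrightarrow> F xs = F ys)"

definition mprod :: "('a \<Rightarrow> 'b::comm_monoid_mult) \<Rightarrow> 'a list \<Rightarrow> 'b" where
  "mprod z xs = prod_list (map z xs)"

definition form_val :: "nat \<Rightarrow> 'a set \<Rightarrow> ('a list \<Rightarrow> complex) \<Rightarrow> ('a \<Rightarrow> complex) \<Rightarrow> complex" where
  "form_val m I c z = (\<Sum>xs\<in>tup m I. c xs * mprod z xs)"

lemma finite_tup [simp]: "finite I \<Longrightarrow> finite (tup m I)"
  unfolding tup_def using finite_lists_length_eq[of I m] by (simp add: conj_commute)

lemma tup_0 [simp]: "tup 0 I = {[]}"
  by (auto simp: tup_def)

lemma tup_empty: "tup m {} = (if m = 0 then {[]} else {})"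
  by (auto simp: tup_def)

lemma sum_tup_Suc:
  assumes "finite I"
  shows "(\<Sum>xs\<in>tup (Suc m) I. F xs) = (\<Sum>i\<in>I. \<Sum>xs\<in>tup m I. F (i # xs))"
proof -
  have "tup (Suc m) I = (\<lambda>(i, xs). i # xs) ` (I \<times> tup m I)"
    by (force simp: tup_def length_Suc_conv)
  moreover have "inj_on (\<lambda>(i, xs). i # xs) (I \<times> tup m I)"
    by (auto simp: inj_on_def)
  ultimately show ?thesis
    using assms by (simp add: sum.reindex sum.cartesian_product case_prod_unfold)
qed

lemma mprod_simps [simp]:
  "mprod z [] = 1" "mprod z (x # xs) = z x * mprod z xs"
  "mprod z (xs @ ys) = mprod z xs * mprod z ys" "mprod z (replicate t j) = z j ^ t"
  by (simp_all add: mprod_def)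

lemma mprod_cong: "(\<And>i. i \<in> set xs \<Longrightarrow> z i = w i) \<Longrightarrow> mprod z xs = mprod w xs"
  by (induction xs) auto

lemma mprod_mset: "mset xs = mset ys \<Longrightarrow> mprod z xs = mprod z ys"
  unfolding mprod_def by (metis mset_map prod_mset_prod_list)

lemma mprod_mult: "mprod (\<lambda>i. z i * w i) xs = mprod z xs * mprod w xs"
  by (induction xs) (auto simp: mult_ac)

lemma norm_mprod: "norm (mprod z xs :: complex) = mprod (\<lambda>i. norm (z i)) xs"
  by (induction xs) (auto simp: norm_mult)

lemma mprod_count:
  assumes "finite I" "set xs \<subseteq> I"
  shows "mprod z xs = (\<Prod>i\<in>I. z i ^ count_list xs i)"
  using assms(2)
proof (induction xs)
  case (Cons x xs)
  have "(\<Prod>i\<in>I. z i ^ count_list (x # xs) i) = (\<Prod>i\<in>I. (if i = x then z i else 1) * z i ^ count_list xs i)"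
    by (intro prod.cong) auto
  also have "\<dots> = z x * (\<Prod>i\<in>I. z i ^ count_list xs i)"
    using Cons.prems assms(1) by (simp add: prod.distrib)
  finally show ?case using Cons by simp
qed auto

lemma symm_onD: "symm_on m I F \<Longrightarrow> xs \<in> tup m I \<Longrightarrow> mset xs = mset ys \<Longrightarrow> F xs = F ys"
  unfolding symm_on_def by blast

lemma tup_mset: "xs \<in> tup m I \<Longrightarrow> mset xs = mset ys \<Longrightarrow> ys \<in> tup m I"
  by (metis (mono_tags, lifting) mem_Collect_eq mset_eq_length set_mset_mset tup_def)

text \<open>By symmetry the copies of \<open>j\<close> can be gathered in front, and
  \<open>m choose t\<close> counts their positions. The induction peels off the first entry,
  distinguishing whether it is \<open>j\<close>; Pascal's rule merges the two resulting
  sums.\<close>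

lemma sum_tup_split:
  fixes F :: "'a list \<Rightarrow> 'b::comm_semiring_1"
  assumes "finite J" "j \<notin> J" "symm_on m (insert j J) F"
  shows "(\<Sum>xs\<in>tup m (insert j J). F xs)
           = (\<Sum>t\<le>m. of_nat (m choose t) * (\<Sum>l\<in>tup (m - t) J. F (replicate t j @ l)))"
  using assms(3)
proof (induction m arbitrary: F)
  case (Suc m)
  let ?I = "insert j J"
  have sym: "symm_on m ?I (\<lambda>xs. F (i # xs))" if "i \<in> ?I" for i
    using that Suc.prems unfolding symm_on_def tup_def by auto
  have "(\<Sum>xs\<in>tup (Suc m) ?I. F xs) = (\<Sum>xs\<in>tup m ?I. F (j # xs)) + (\<Sum>i\<in>J. \<Sum>xs\<in>tup m ?I. F (i # xs))"
    using assms by (simp add: sum_tup_Suc)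
  also have "(\<Sum>xs\<in>tup m ?I. F (j # xs)) =
      (\<Sum>t\<le>m. of_nat (m choose t) * (\<Sum>l\<in>tup (m - t) J. F (replicate (Suc t) j @ l)))"
    using Suc.IH[OF sym[of j]] by simp
  also have "(\<Sum>i\<in>J. \<Sum>xs\<in>tup m ?I. F (i # xs)) =
      (\<Sum>i\<in>J. \<Sum>t\<le>m. of_nat (m choose t) * (\<Sum>l\<in>tup (m - t) J. F (i # replicate t j @ l)))"
    using Suc.IH[OF sym] by (intro sum.cong) auto
  also have "\<dots> = (\<Sum>t\<le>m. of_nat (m choose t) * (\<Sum>i\<in>J. \<Sum>l\<in>tup (m - t) J. F (i # replicate t j @ l)))"
    by (subst sum.swap) (simp add: sum_distrib_left)
  also have "\<dots> = (\<Sum>t\<le>m. of_nat (m choose t) * (\<Sum>l\<in>tup (Suc m - t) J. F (replicate t j @ l)))"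
  proof (intro sum.cong refl arg_cong2[of _ _ _ _ "(*)"])
    fix t assume t: "t \<in> {..m}"
    have "F (i # replicate t j @ l) = F (replicate t j @ i # l)" if "i \<in> J" "l \<in> tup (m - t) J" for i l
      by (rule symm_onD[OF Suc.prems]) (use that t in \<open>auto simp: tup_def\<close>)
    then show "(\<Sum>i\<in>J. \<Sum>l\<in>tup (m - t) J. F (i # replicate t j @ l)) = (\<Sum>l\<in>tup (Suc m - t) J. F (replicate t j @ l))"
      using t assms(1) by (simp add: sum_tup_Suc Suc_diff_le)
  qed
  also have "(\<Sum>t\<le>m. of_nat (m choose t) * (\<Sum>l\<in>tup (m - t) J. F (replicate (Suc t) j @ l))) + \<dots> =
      (\<Sum>t\<le>Suc m. of_nat (Suc m choose t) * (\<Sum>l\<in>tup (Suc m - t) J. F (replicate t j @ l)))"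
    (is "?A + ?B = _")
  proof -
    let ?G = "\<lambda>t. \<Sum>l\<in>tup (Suc m - t) J. F (replicate t j @ l)"
    have "(\<Sum>t\<le>Suc m. of_nat (Suc m choose t) * ?G t) = ?G 0 + (\<Sum>t\<le>m. of_nat (Suc m choose Suc t) * ?G (Suc t))"
      by (subst sum.atMost_Suc_shift) simp
    also have "\<dots> = ?G 0 + (?A + (\<Sum>t\<le>m. of_nat (m choose Suc t) * ?G (Suc t)))"
      by (simp add: algebra_simps sum.distrib)
    also have "(\<Sum>t\<le>m. of_nat (m choose Suc t) * ?G (Suc t)) = (\<Sum>t<m. of_nat (m choose Suc t) * ?G (Suc t))"
      by (rule sum.mono_neutral_right) (auto simp: not_less le_less binomial_eq_0)
    also have "?G 0 + (?A + \<dots>) = ?A + (?G 0 + \<dots>)" by (simp add: ac_simps)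
    also have "?G 0 + (\<Sum>t<m. of_nat (m choose Suc t) * ?G (Suc t)) = ?B"
      by (subst sum.atMost_shift) simp
    finally show ?thesis by simp
  qed
  finally show ?case .
qed auto

section \<open>Roots of unity\<close>

definition unity_root :: "nat \<Rightarrow> nat \<Rightarrow> complex" where
  "unity_root N r = cis (2 * pi * real r / real N)"

lemma norm_unity_root [simp]: "norm (unity_root N r) = 1"
  by (simp add: unity_root_def)

lemma unity_root_neq_0 [simp]: "unity_root N r \<noteq> 0"
  using norm_unity_root[of N r] by fastforce

lemma sum_unity_root_power:
  assumes "N > 0"
  shows "(\<Sum>r<N. unity_root N r ^ k) = (if N dvd k then of_nat N else 0)"
proof -
  let ?w = "unity_root N k"
  have pw: "unity_root N r ^ k = ?w ^ r" for r
    unfolding unity_root_def Complex.DeMoivre by (intro arg_cong[of _ _ cis]) (simp add: field_simps)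
  have iff: "?w = 1 \<longleftrightarrow> N dvd k"
  proof -
    have "?w = exp (2 * of_real pi * \<i> * of_nat k / of_nat N)"
      by (simp add: unity_root_def cis_conv_exp algebra_simps)
    then show ?thesis using complex_root_unity_eq_1[of N k] assms by simp
  qed
  show ?thesis
  proof (cases "N dvd k")
    case True then show ?thesis using iff pw by simp
  next
    case False
    have "?w ^ N = 1"
      using assms by (simp only: unity_root_def Complex.DeMoivre) (simp add: cis_multiple_2pi)
    moreover have "?w \<noteq> 1" using False iff by simp
    ultimately show ?thesis using False pw by (simp add: sum_gp_strict)
  qed
qed

lemma unity_root_power_cnj:
  assumes "t \<le> N" "N > 0"
  shows "unity_root N r ^ (N - t) = cnj (unity_root N r ^ t)"
proof -
  let ?w = "unity_root N r"
  have "?w ^ N = 1"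
    using assms by (simp only: unity_root_def Complex.DeMoivre) (simp add: cis_multiple_2pi)
  then have "?w ^ (N - t) * ?w ^ t = 1"
    using assms by (simp flip: power_add)
  moreover have "cnj ?w * ?w = 1"
    using complex_norm_square[of ?w] by (simp add: mult.commute)
  then have "cnj (?w ^ t) * ?w ^ t = 1"
    by (simp flip: power_mult_distrib)
  ultimately show ?thesis
    by (metis mult_cancel_right zero_neq_one mult_zero_right)
qed

text \<open>Discrete Fourier inversion, where the power \<open>N - t\<close> stands for the
  frequency \<open>-t\<close>. As \<open>N > 2 * d\<close>, the frequencies \<open>k + t\<close>, at
  most \<open>2 * d\<close>, never wrap around to a multiple of \<open>N\<close>.\<close>

lemma unity_root_coeffs:
  fixes b :: "nat \<Rightarrow> complex"
  assumes t: "1 \<le> t" "t \<le> d" and N: "2 * d < N"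
  defines "f \<equiv> \<lambda>w. \<Sum>k\<le>d. b k * w ^ k"
  shows "(\<Sum>r<N. f (unity_root N r)) = of_nat N * b 0"
    and "(\<Sum>r<N. f (unity_root N r) * unity_root N r ^ (N - t)) = of_nat N * b t"
    and "(\<Sum>r<N. f (unity_root N r) * unity_root N r ^ t) = 0"
proof -
  have N0: "N > 0" using N by simp
  have shift: "(\<Sum>r<N. f (unity_root N r) * unity_root N r ^ s) = of_nat N * (\<Sum>k\<le>d. if N dvd k + s then b k else 0)" for s
  proof -
    have "(\<Sum>r<N. f (unity_root N r) * unity_root N r ^ s) = (\<Sum>k\<le>d. b k * (\<Sum>r<N. unity_root N r ^ (k + s)))"
      unfolding f_def sum_distrib_right sum_distrib_left by (subst sum.swap) (simp add: power_add mult_ac)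
    then show ?thesis using N0 by (simp add: sum_unity_root_power sum_distrib_left if_distrib mult_ac cong: if_cong)
  qed
  show "(\<Sum>r<N. f (unity_root N r)) = of_nat N * b 0"
  proof -
    have "N dvd k \<longleftrightarrow> k = 0" if "k \<le> d" for k using that N by (auto dest: dvd_imp_le)
    then have "(\<Sum>k\<le>d. if N dvd k + 0 then b k else 0) = (\<Sum>k\<le>d. if k = 0 then b k else 0)"
      by (intro sum.cong) auto
    then show ?thesis using shift[of 0] by simp
  qed
  show "(\<Sum>r<N. f (unity_root N r) * unity_root N r ^ (N - t)) = of_nat N * b t"
  proof -
    have "N dvd k + (N - t) \<longleftrightarrow> k = t" if "k \<le> d" for k
    proof
      assume "N dvd k + (N - t)"
      then obtain q where q: "k + (N - t) = N * q" by auto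
      have "N * q < N * 2" "0 < N * q" using q that t N by linarith+
      then have "q = 1" by simp
      then show "k = t" using q t N by simp
    qed (use t N in auto)
    then have "(\<Sum>k\<le>d. if N dvd k + (N - t) then b k else 0) = (\<Sum>k\<le>d. if k = t then b k else 0)"
      by (intro sum.cong) auto
    then show ?thesis using shift[of "N - t"] t by simp
  qed
  show "(\<Sum>r<N. f (unity_root N r) * unity_root N r ^ t) = 0"
  proof -
    have "\<not> N dvd k + t" if "k \<le> d" for k
      using that t N by (auto dest: dvd_imp_le)
    then show ?thesis using shift[of t] by simp
  qed
qed

text \<open>The test function \<open>\<alpha> + \<beta> \<omega>\<^sup>-\<^sup>t - \<beta>\<^sup>* \<omega>\<^sup>t\<close>, \<open>\<alpha>\<close> real, has modulus at most
  \<open>\<surd>(\<alpha>\<^sup>2 + 4 |\<beta>|\<^sup>2)\<close>, and its last term is orthogonal to \<open>f\<close>, which has no negative frequencies.\<close>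

lemma two_coeffs_le_mean:
  fixes b :: "nat \<Rightarrow> complex"
  assumes t: "1 \<le> t" "t \<le> d" and N: "2 * d < N"
  defines "f \<equiv> \<lambda>w. \<Sum>k\<le>d. b k * w ^ k"
  shows "(norm (b 0))\<^sup>2 + (norm (b t))\<^sup>2 / 4 \<le> ((\<Sum>r<N. norm (f (unity_root N r))) / N)\<^sup>2"
proof -
  define e where "e = (if b 0 = 0 then 1 else sgn (b 0))"
  have e: "norm e = 1" "b 0 = norm (b 0) * e"
    by (auto simp: e_def sgn_eq norm_divide)
  \<comment> \<open>The factor 1/4 makes two numbers equal to \<open>R\<close>: the averaged pairing
    of \<open>f\<close> with \<open>\<kappa>\<close>, and the square of the bound on
    \<open>\<kappa>\<close>, in which \<open>4 * (norm \<beta>)\<^sup>2\<close> is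
    \<open>(norm (b t))\<^sup>2 / 4\<close>.\<close>
  define \<beta> where "\<beta> = cnj (b t) * e / 4"
  define \<kappa> where "\<kappa> = (\<lambda>w. cnj e * (norm (b 0) + \<beta> * w ^ (N - t) - cnj \<beta> * w ^ t))"
  define R where "R = (norm (b 0))\<^sup>2 + (norm (b t))\<^sup>2 / 4"
  define E where "E = (\<Sum>r<N. norm (f (unity_root N r))) / N"
  have N0: "N > 0" using N by simp
  have E0: "E \<ge> 0" by (simp add: E_def sum_nonneg)
  have ee: "cnj e * e = 1" using e(1)
    by (simp add: mult.commute complex_norm_square[symmetric])
  have s0: "(\<Sum>r<N. f (unity_root N r)) = of_nat N * b 0"
    and st: "(\<Sum>r<N. f (unity_root N r) * unity_root N r ^ (N - t)) = of_nat N * b t"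
    and sm: "(\<Sum>r<N. f (unity_root N r) * unity_root N r ^ t) = 0"
    unfolding f_def by (rule unity_root_coeffs[OF assms(1-3)])+
  have "(\<Sum>r<N. f (unity_root N r) * \<kappa> (unity_root N r)) =
      cnj e * (norm (b 0) * (\<Sum>r<N. f (unity_root N r)) + \<beta> * (\<Sum>r<N. f (unity_root N r) * unity_root N r ^ (N - t))
        - cnj \<beta> * (\<Sum>r<N. f (unity_root N r) * unity_root N r ^ t))"
    unfolding \<kappa>_def sum_distrib_left sum.distrib[symmetric] sum_subtractf[symmetric]
    by (intro sum.cong) (auto simp: algebra_simps)
  also have "\<dots> = of_nat N * (cnj e * (norm (b 0) * b 0 + \<beta> * b t))"
    by (simp add: s0 st sm algebra_simps)
  also have "cnj e * (norm (b 0) * b 0 + \<beta> * b t) = R"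
  proof -
    have "cnj e * (norm (b 0) * b 0) = (norm (b 0))\<^sup>2"
      by (subst (2) e(2)) (use ee in \<open>simp add: power2_eq_square mult_ac\<close>)
    moreover have "cnj e * (\<beta> * b t) = (cnj e * e) * (b t * cnj (b t)) / 4"
      by (simp add: \<beta>_def)
    then have "cnj e * (\<beta> * b t) = (norm (b t))\<^sup>2 / 4"
      by (simp add: ee complex_norm_square[symmetric])
    ultimately show ?thesis by (simp add: distrib_left R_def)
  qed
  finally have main: "(\<Sum>r<N. f (unity_root N r) * \<kappa> (unity_root N r)) = of_nat N * of_real R" .
  have R0: "R \<ge> 0" by (simp add: R_def)
  have \<kappa>: "norm (\<kappa> (unity_root N r)) \<le> sqrt R" for r
  proof -
    let ?w = "unity_root N r"
    define u where "u = cnj \<beta> * ?w ^ t"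
    have "\<beta> * ?w ^ (N - t) = cnj u"
      using t N by (simp add: unity_root_power_cnj u_def)
    then have "\<kappa> ?w = cnj e * (norm (b 0) + (cnj u - u))"
      by (simp add: \<kappa>_def u_def)
    \<comment> \<open>Purely imaginary, hence orthogonal to the real number
      \<open>norm (b 0)\<close>: the squared moduli add up.\<close>
    also have "cnj u - u = - (2 * \<i> * Im u)"
      by (simp add: complex_eq_iff)
    finally have "(norm (\<kappa> ?w))\<^sup>2 = (norm (b 0))\<^sup>2 + 4 * (Im u)\<^sup>2"
      using e(1) by (simp add: norm_mult cmod_power2 power_mult_distrib)
    also have "(Im u)\<^sup>2 \<le> (norm u)\<^sup>2"
      by (simp add: cmod_power2)
    also have "norm u = norm (b t) / 4"
      using e(1) by (simp add: u_def \<beta>_def norm_mult norm_power norm_divide)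
    finally have "(norm (\<kappa> ?w))\<^sup>2 \<le> R" by (simp add: R_def power_divide)
    then show ?thesis by (simp add: real_le_rsqrt)
  qed
  have "N * R \<le> norm (\<Sum>r<N. f (unity_root N r) * \<kappa> (unity_root N r))"
    unfolding main using R0 by (simp add: norm_mult)
  also have "\<dots> \<le> (\<Sum>r<N. norm (f (unity_root N r)) * sqrt R)"
    by (intro order_trans[OF norm_sum] sum_mono) (simp add: norm_mult mult_left_mono \<kappa>)
  also have "\<dots> = N * (E * sqrt R)"
    using N0 by (simp add: E_def sum_distrib_right)
  finally have "R \<le> E * sqrt R" using N0 by simp
  then have "sqrt R * sqrt R \<le> E * sqrt R" using R0 by simp
  then have "sqrt R \<le> E"
    using E0 R0 by (cases "R = 0") (auto simp del: real_sqrt_mult_self dest: mult_right_le_imp_le)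
  then show ?thesis
    unfolding R_def[symmetric] E_def[symmetric] by (rule sqrt_le_D)
qed

section \<open>An inequality between the first and second moments\<close>

text \<open>Sample index \<open>0\<close> is the point \<open>0\<close>, with weight \<open>1/2\<close>; the remaining indices are the \<open>N\<close>-th roots of
  unity, shifted by one.\<close>

definition sample_pt :: "nat \<Rightarrow> nat \<Rightarrow> complex" where
  "sample_pt N r = (case r of 0 \<Rightarrow> 0 | Suc k \<Rightarrow> unity_root N k)"

definition sample_wt :: "nat \<Rightarrow> nat \<Rightarrow> real" where
  "sample_wt N r = (if r = 0 then 1 / 2 else 1 / (2 * real N))"

text \<open>The expectation over independent sample points. The atom at 0 later allows a sum over
  the vanishing variables only: each vanishes with probability 1/2, independently of the
  others.\<close>

definition sample_mean :: "nat \<Rightarrow> 'a set \<Rightarrow> (('a \<Rightarrow> complex) \<Rightarrow> real) \<Rightarrow> real" where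
  "sample_mean N I F = (\<Sum>g\<in>I \<rightarrow>\<^sub>E {..N}. (\<Prod>i\<in>I. sample_wt N (g i)) * F (\<lambda>i. sample_pt N (g i)))"

lemma norm_sample_pt_le_1: "norm (sample_pt N r) \<le> 1"
  by (simp add: sample_pt_def split: nat.split)

lemma sample_wt_nonneg [simp]: "sample_wt N r \<ge> 0"
  by (simp add: sample_wt_def)

lemma sum_sample_wt:
  assumes "N > 0"
  shows "(\<Sum>r\<le>N. sample_wt N r * h (sample_pt N r)) = h 0 / 2 + (\<Sum>r<N. h (unity_root N r)) / (2 * N)"
proof -
  have "{..N} = insert 0 (Suc ` {..<N})"
    by (metis atMost_Suc_eq_insert_0 image_Suc_lessThan lessThan_Suc_atMost lessThan_Suc_eq_insert_0)
  then show ?thesis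
    by (simp add: sum.reindex sample_wt_def sample_pt_def sum_divide_distrib)
qed

lemma sample_mean_insert:
  assumes "finite I" "j \<notin> I"
  shows "sample_mean N (insert j I) F = (\<Sum>r\<le>N. sample_wt N r * sample_mean N I (\<lambda>z. F (z(j := sample_pt N r))))"
proof -
  have *: "(\<lambda>i. sample_pt N ((g(j := r)) i)) = (\<lambda>i. sample_pt N (g i))(j := sample_pt N r)" for g r
    by auto
  have **: "(\<Prod>i\<in>I. sample_wt N ((g(j := r)) i)) = (\<Prod>i\<in>I. sample_wt N (g i))" for g r
    using assms by (intro prod.cong) auto
  have "sample_mean N (insert j I) F = (\<Sum>(r, g)\<in>{..N} \<times> (I \<rightarrow>\<^sub>E {..N}).
      (sample_wt N r * (\<Prod>i\<in>I. sample_wt N (g i))) * F ((\<lambda>i. sample_pt N (g i))(j := sample_pt N r)))"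
    unfolding sample_mean_def PiE_insert_eq
    by (subst sum.reindex)
       (use assms inj_combinator[of j I "\<lambda>_. {..N}"] in \<open>auto simp: case_prod_unfold * ** fun_upd_same simp del: fun_upd_apply intro!: sum.cong\<close>)
  also have "\<dots> = (\<Sum>r\<le>N. sample_wt N r * sample_mean N I (\<lambda>z. F (z(j := sample_pt N r))))"
    by (subst sum.cartesian_product[symmetric]) (simp add: sample_mean_def sum_distrib_left mult_ac)
  finally show ?thesis .
qed

lemma sample_mean_sum: "sample_mean N I (\<lambda>z. \<Sum>k\<in>A. F k z) = (\<Sum>k\<in>A. sample_mean N I (F k))"
  unfolding sample_mean_def sum_distrib_left by (rule sum.swap)

lemma sample_mean_cmult: "sample_mean N I (\<lambda>z. a * F z) = a * sample_mean N I F"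
  unfolding sample_mean_def sum_distrib_left by (simp add: mult_ac)

lemma sample_mean_mono:
  assumes "\<And>z. (\<And>i. i \<in> I \<Longrightarrow> norm (z i) \<le> 1) \<Longrightarrow> F z \<le> G z"
  shows "sample_mean N I F \<le> sample_mean N I G"
  unfolding sample_mean_def
  by (intro sum_mono mult_left_mono assms norm_sample_pt_le_1 prod_nonneg) auto

lemma sample_mean_nonneg: "(\<And>z. F z \<ge> 0) \<Longrightarrow> sample_mean N I F \<ge> 0"
  unfolding sample_mean_def by (intro sum_nonneg mult_nonneg_nonneg prod_nonneg) auto

lemma sample_mean_const:
  assumes "finite I" "N > 0"
  shows "sample_mean N I (\<lambda>_. a) = a"
  using assms(1)
proof induction
  case empty
  then show ?case by (simp add: sample_mean_def)
next
  case (insert j I)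
  then show ?case using sum_sample_wt[OF assms(2), of "\<lambda>_. a"] assms(2)
    by (simp add: sample_mean_insert)
qed

text \<open>The atom at 0 contributes half of \<open>norm (b 0)\<close>, the roots of unity half of
  their mean. The triangle inequality in the plane for \<open>(x / 2, 0) + (x / 2, y / 4)\<close>
  combines them; the price of the atom is 16 in place of 4.\<close>

lemma two_coeffs_le_avg:
  fixes b :: "nat \<Rightarrow> complex"
  assumes t: "1 \<le> t" "t \<le> d" and N: "2 * d < N"
  shows "sqrt ((norm (b 0))\<^sup>2 + (norm (b t))\<^sup>2 / 16) \<le> (\<Sum>r\<le>N. sample_wt N r * norm (\<Sum>k\<le>d. b k * sample_pt N r ^ k))"
proof -
  let ?x = "norm (b 0)" and ?y = "norm (b t)"
  let ?m = "(\<Sum>r<N. norm (\<Sum>k\<le>d. b k * unity_root N r ^ k)) / N"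
  have m: "sqrt (?x\<^sup>2 + ?y\<^sup>2 / 4) \<le> ?m"
    using two_coeffs_le_mean[OF assms] by (intro real_le_lsqrt) (auto intro!: divide_nonneg_nonneg sum_nonneg)
  have "sqrt (?x\<^sup>2 + ?y\<^sup>2 / 16) = norm (Complex ?x (?y / 4))"
    by (simp add: complex_norm power_divide)
  also have "Complex ?x (?y / 4) = Complex (?x / 2) 0 + Complex (?x / 2) (?y / 4)"
    by (simp add: complex_eq_iff)
  also have "norm \<dots> \<le> norm (Complex (?x / 2) 0) + norm (Complex (?x / 2) (?y / 4))"
    by (rule norm_triangle_ineq)
  also have "norm (Complex (?x / 2) (?y / 4)) = sqrt ((?x\<^sup>2 + ?y\<^sup>2 / 4) / 4)"
    by (simp add: complex_norm power_divide)
  also have "\<dots> = sqrt (?x\<^sup>2 + ?y\<^sup>2 / 4) / 2"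
    by (simp add: real_sqrt_divide)
  also have "norm (Complex (?x / 2) 0) = ?x / 2"
    by (simp add: complex_norm)
  also have "?x / 2 + sqrt (?x\<^sup>2 + ?y\<^sup>2 / 4) / 2 \<le> ?x / 2 + ?m / 2"
    using m by simp
  also have "\<dots> = (\<Sum>r\<le>N. sample_wt N r * norm (\<Sum>k\<le>d. b k * sample_pt N r ^ k))"
  proof -
    have "(\<Sum>k\<le>d. b k * 0 ^ k) = b 0"
      by (simp add: power_0_left if_distrib cong: if_cong)
    then show ?thesis
      using N sum_sample_wt[of N "\<lambda>w. norm (\<Sum>k\<le>d. b k * w ^ k)"] by simp
  qed
  finally show ?thesis .
qed

text \<open>Minkowski's inequality: the norm of the mean of the planar vectors
  \<open>(X, Y / 4)\<close> is at most the mean of their norms.\<close>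

lemma sqrt_sample_mean_le:
  "sqrt ((sample_mean N I X)\<^sup>2 + (sample_mean N I Y)\<^sup>2 / 16) \<le> sample_mean N I (\<lambda>z. sqrt ((X z)\<^sup>2 + (Y z)\<^sup>2 / 16))"
proof -
  let ?w = "\<lambda>g. \<Prod>i\<in>I. sample_wt N (g i)" and ?z = "\<lambda>g i. sample_pt N (g i)"
  let ?A = "I \<rightarrow>\<^sub>E {..N}"
  have "sqrt ((sample_mean N I X)\<^sup>2 + (sample_mean N I Y)\<^sup>2 / 16) = norm (Complex (sample_mean N I X) (sample_mean N I Y / 4))"
    by (simp add: complex_norm power_divide)
  also have "Complex (sample_mean N I X) (sample_mean N I Y / 4) = (\<Sum>g\<in>?A. ?w g *\<^sub>R Complex (X (?z g)) (Y (?z g) / 4))"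
    by (simp add: complex_eq_iff sample_mean_def sum_divide_distrib)
  also have "norm \<dots> \<le> (\<Sum>g\<in>?A. norm (?w g *\<^sub>R Complex (X (?z g)) (Y (?z g) / 4)))"
    by (rule norm_sum)
  also have "\<dots> = sample_mean N I (\<lambda>z. sqrt ((X z)\<^sup>2 + (Y z)\<^sup>2 / 16))"
    by (simp add: sample_mean_def complex_norm power_divide prod_nonneg)
  finally show ?thesis .
qed

text \<open>The one-variable bound holds with the variables of \<open>J\<close> frozen; Minkowski's
  inequality carries both coefficients through the mean over \<open>J\<close>.\<close>

lemma two_coeffs_le_sample_mean:
  assumes "1 \<le> t" "t \<le> d" "2 * d < N" "finite J" "j \<notin> J"
    and f: "\<And>z w. f (z(j := w)) = (\<Sum>k\<le>d. b k z * w ^ k)"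
  shows "(sample_mean N J (\<lambda>z. norm (b 0 z)))\<^sup>2 + (sample_mean N J (\<lambda>z. norm (b t z)))\<^sup>2 / 16
           \<le> (sample_mean N (insert j J) (\<lambda>z. norm (f z)))\<^sup>2"
proof -
  have "sqrt ((sample_mean N J (\<lambda>z. norm (b 0 z)))\<^sup>2 + (sample_mean N J (\<lambda>z. norm (b t z)))\<^sup>2 / 16)
      \<le> sample_mean N J (\<lambda>z. sqrt ((norm (b 0 z))\<^sup>2 + (norm (b t z))\<^sup>2 / 16))"
    by (rule sqrt_sample_mean_le)
  also have "\<dots> \<le> sample_mean N J (\<lambda>z. \<Sum>r\<le>N. sample_wt N r * norm (f (z(j := sample_pt N r))))"
    unfolding f by (intro sample_mean_mono two_coeffs_le_avg assms)
  also have "\<dots> = sample_mean N (insert j J) (\<lambda>z. norm (f z))"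
    using assms by (simp add: sample_mean_sum sample_mean_cmult sample_mean_insert)
  finally show ?thesis by (rule sqrt_le_D)
qed

lemma symm_on_replicate_append:
  assumes "symm_on d I e" "j \<in> I" "J \<subseteq> I" "t \<le> d"
  shows "symm_on (d - t) J (\<lambda>l. e (replicate t j @ l))"
  unfolding symm_on_def
proof (intro ballI allI impI)
  fix xs ys assume "xs \<in> tup (d - t) J" "mset xs = mset ys"
  then show "e (replicate t j @ xs) = e (replicate t j @ ys)"
    using assms by (intro symm_onD[OF assms(1)]) (auto simp: tup_def)
qed

lemma form_val_split:
  assumes "finite J" "j \<notin> J" "symm_on d (insert j J) e"
  shows "form_val d (insert j J) e (z(j := w)) =
    (\<Sum>t\<le>d. of_nat (d choose t) * form_val (d - t) J (\<lambda>l. e (replicate t j @ l)) z * w ^ t)"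
proof -
  have "symm_on d (insert j J) (\<lambda>xs. e xs * mprod (z(j := w)) xs)"
    using assms(3) mprod_mset unfolding symm_on_def by metis
  moreover have "mprod (z(j := w)) l = mprod z l" if "l \<in> tup k J" for l k
    by (rule mprod_cong) (use that assms(2) in \<open>auto simp: tup_def\<close>)
  ultimately show ?thesis
    unfolding form_val_def using assms
    by (subst sum_tup_split) (auto simp: sum_distrib_left sum_distrib_right mult_ac intro!: sum.cong)
qed

text \<open>Induction on the number of variables: \<open>two_coeffs_le_sample_mean\<close> is applied to the new variable, and the
  pairs \<open>(0, t)\<close> are combined with weights proportional to \<open>G (d - t) / (d choose t)\<close>.\<close>

lemma sum_norm_sq_le_sample_mean:
  fixes G :: "nat \<Rightarrow> real"
  assumes G0: "G 0 = 1" and Gpos: "\<And>d. G d > 0"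
    and G: "\<And>d. d > 0 \<Longrightarrow> 16 * (\<Sum>t=1..d. G (d - t) / (d choose t)) \<le> G d"
    and "finite J" "2 * d < N" "symm_on d J e"
  shows "(\<Sum>l\<in>tup d J. (norm (e l))\<^sup>2) \<le> G d * (sample_mean N J (\<lambda>z. norm (form_val d J e z)))\<^sup>2"
  using assms(4-6)
proof (induction J arbitrary: d e)
  case empty
  show ?case
  proof (cases "d = 0")
    case True
    then show ?thesis using G0 by (simp add: form_val_def sample_mean_def)
  next
    case False
    then show ?thesis using Gpos[of d] by (simp add: tup_empty)
  qed
next
  case (insert j J)
  define S where "S t = (\<Sum>l\<in>tup (d - t) J. (norm (e (replicate t j @ l)))\<^sup>2)" for t
  define b where "b t z = of_nat (d choose t) * form_val (d - t) J (\<lambda>l. e (replicate t j @ l)) z" for t z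
  define X where "X t = sample_mean N J (\<lambda>z. norm (b t z))" for t
  define E where "E = sample_mean N (insert j J) (\<lambda>z. norm (form_val d (insert j J) e z))"
  have fv: "form_val d (insert j J) e (z(j := w)) = (\<Sum>k\<le>d. b k z * w ^ k)" for z w
    unfolding b_def by (rule form_val_split) (use insert in auto)
  have "symm_on d (insert j J) (\<lambda>xs. (norm (e xs))\<^sup>2)"
    using insert.prems(2) unfolding symm_on_def by metis
  then have "(\<Sum>l\<in>tup d (insert j J). (norm (e l))\<^sup>2) = (\<Sum>t\<le>d. real (d choose t) * S t)"
    unfolding S_def using insert by (subst sum_tup_split) auto
  also have "\<dots> = S 0 + (\<Sum>t=1..d. real (d choose t) * S t)"
    by (simp add: sum.atLeast1_atMost_eq sum.atMost_shift)
  also have "\<dots> \<le> G d * E\<^sup>2"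
  proof (cases "d = 0")
    case True
    have "E = norm (e [])"
      using insert True by (simp add: E_def form_val_def sample_mean_const)
    then show ?thesis using True G0 by (simp add: S_def)
  next
    case False
    have S: "(real (d choose t))\<^sup>2 * S t \<le> G (d - t) * (X t)\<^sup>2" if "t \<le> d" for t
    proof -
      have "S t \<le> G (d - t) * (sample_mean N J (\<lambda>z. norm (form_val (d - t) J (\<lambda>l. e (replicate t j @ l)) z)))\<^sup>2"
        unfolding S_def using insert.prems that
        by (intro insert.IH symm_on_replicate_append[of d "insert j J"]) auto
      then have "(real (d choose t))\<^sup>2 * S t \<le>
          (real (d choose t))\<^sup>2 * (G (d - t) * (sample_mean N J (\<lambda>z. norm (form_val (d - t) J (\<lambda>l. e (replicate t j @ l)) z)))\<^sup>2)"
        by (intro mult_left_mono) auto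
      also have "\<dots> = G (d - t) * (X t)\<^sup>2"
        by (simp add: X_def b_def norm_mult sample_mean_cmult power_mult_distrib mult_ac)
      finally show ?thesis .
    qed
    have XE: "(X 0)\<^sup>2 + (X t)\<^sup>2 / 16 \<le> E\<^sup>2" if "1 \<le> t" "t \<le> d" for t
      unfolding X_def E_def using that insert fv by (intro two_coeffs_le_sample_mean) auto
    have D: "(X 0)\<^sup>2 \<le> E\<^sup>2" using XE[of 1] False by (smt (verit) Suc_leI neq0_conv One_nat_def zero_le_power2 le_refl divide_nonneg_nonneg)
    \<comment> \<open>For every \<open>t\<close> the square of \<open>X t\<close> is at most 16
      times the same slack \<open>E\<^sup>2 - (X 0)\<^sup>2\<close>. The recursive hypothesis on
      \<open>G\<close> bounds the total weight put on this slack by \<open>G d\<close>, and the term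
      \<open>t = 0\<close> supplies the missing \<open>G d * (X 0)\<^sup>2\<close>.\<close>
    have "(\<Sum>t=1..d. real (d choose t) * S t) \<le> (\<Sum>t=1..d. 16 * (G (d - t) / (d choose t)) * (E\<^sup>2 - (X 0)\<^sup>2))"
    proof (rule sum_mono)
      fix t assume t: "t \<in> {1..d}"
      then have c: "real (d choose t) > 0" by simp
      have "real (d choose t) * S t \<le> G (d - t) / (d choose t) * (X t)\<^sup>2"
        using S[of t] t c by (simp add: field_simps power2_eq_square)
      also have "\<dots> \<le> G (d - t) / (d choose t) * (16 * (E\<^sup>2 - (X 0)\<^sup>2))"
        using XE[of t] t Gpos[of "d - t"] by (intro mult_left_mono) auto
      finally show "real (d choose t) * S t \<le> 16 * (G (d - t) / (d choose t)) * (E\<^sup>2 - (X 0)\<^sup>2)"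
        by (simp only: mult_ac)
    qed
    also have "\<dots> = 16 * (\<Sum>t=1..d. G (d - t) / (d choose t)) * (E\<^sup>2 - (X 0)\<^sup>2)"
      by (simp only: sum_distrib_left sum_distrib_right)
    also have "\<dots> \<le> G d * (E\<^sup>2 - (X 0)\<^sup>2)"
      using G[of d] False D by (intro mult_right_mono) auto
    finally show ?thesis using S[of 0] by (simp add: right_diff_distrib)
  qed
  finally show ?case by (simp add: E_def)
qed

section \<open>Binomial sums and a moment constant independent of the degree\<close>

lemma choose_ge_self:
  assumes "1 \<le> t" "t < m"
  shows "m \<le> m choose t"
  using assms
proof (induction m arbitrary: t)
  case (Suc m)
  then obtain k where t: "t = Suc k" by (cases t) auto
  show ?case
  proof (cases "t = m")
    case True then show ?thesis by simp
  next
    case False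
    then have "m \<le> m choose t" using Suc by auto
    moreover have "m choose k \<ge> 1" using Suc.prems t by (simp add: Suc_le_eq)
    ultimately show ?thesis using t by simp
  qed
qed simp

lemma choose_ge_choose:
  assumes "r \<le> t" "t + r \<le> m"
  shows "m choose r \<le> m choose t"
proof (cases "2 * t \<le> m")
  case True
  then show ?thesis using assms by (intro binomial_mono) auto
next
  case False
  then have "m choose r \<le> m choose (m - t)" using assms by (intro binomial_mono) auto
  then show ?thesis using assms by (simp add: binomial_symmetric[symmetric])
qed

text \<open>The two end terms are \<open>1 / m\<close> each; the fewer than \<open>m\<close>
  remaining ones are at most \<open>1 / (m choose 2)\<close>, so together they add no more than
  \<open>2 / m\<close>.\<close>

lemma sum_inverse_choose_le: "(\<Sum>t=1..<m. 1 / real (m choose t)) \<le> 4 / m"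
proof (cases "m \<le> 3")
  case True
  then have "m = 0 \<or> m = 1 \<or> m = 2 \<or> m = 3" by auto
  then show ?thesis by (auto simp: numeral_eq_Suc)
next
  case False
  then have m: "m \<ge> 4" by simp
  have c2: "real (m choose 2) = m * (m - 1) / 2"
    using m by (simp add: choose_two real_of_nat_div)
  have "{1..<m} = insert 1 (insert (m - 1) {2..<m - 1})" using m by auto
  then have "(\<Sum>t=1..<m. 1 / real (m choose t)) = 1 / m + (1 / m + (\<Sum>t=2..<m - 1. 1 / real (m choose t)))"
    using m binomial_symmetric[of 1 m] by simp
  also have "(\<Sum>t=2..<m - 1. 1 / real (m choose t)) \<le> (\<Sum>t=2..<m - 1. 1 / real (m choose 2))"
  proof (intro sum_mono divide_left_mono)
    fix t assume "t \<in> {2..<m - 1}"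
    then show "real (m choose 2) \<le> real (m choose t)"
      by (intro of_nat_mono choose_ge_choose) auto
    show "0 < real (m choose t) * real (m choose 2)"
      using m \<open>t \<in> {2..<m - 1}\<close> by (auto intro!: mult_pos_pos)
  qed auto
  also have "\<dots> = (real m - 3) * 2 / (m * (real m - 1))"
    unfolding c2 using m by (simp add: of_nat_diff)
  also have "\<dots> \<le> 2 / m"
    using m by (simp add: field_simps)
  finally show ?thesis by (simp add: field_simps)
qed

text \<open>A bounded solution of the recursion. Up to degree 128 the geometric sum with ratio 17
  closes it; beyond that, \<open>16 * (1 + 17 ^ 128 * (4 / d))\<close> stays below
  \<open>17 ^ 128\<close>, since \<open>16 * 4 / 128 = 1 / 2\<close>.\<close>

definition moment_growth :: "nat \<Rightarrow> real" where "moment_growth d = 17 ^ min d 128"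

lemma moment_growth_rec:
  assumes "d > 0"
  shows "16 * (\<Sum>t=1..d. moment_growth (d - t) / (d choose t)) \<le> moment_growth d"
proof (cases "d \<le> 128")
  case True
  have "(\<Sum>t=1..d. moment_growth (d - t) / (d choose t)) \<le> (\<Sum>t=1..d. 17 ^ (d - t))"
  proof (rule sum_mono)
    fix t assume t: "t \<in> {1..d}"
    then have "real (d choose t) \<ge> 1"
      by (metis One_nat_def Suc_leI atLeastAtMost_iff of_nat_1 of_nat_mono zero_less_binomial)
    then show "moment_growth (d - t) / real (d choose t) \<le> 17 ^ (d - t)"
      using t True by (simp add: moment_growth_def divide_le_eq mult_le_cancel_left1)
  qed
  also have "\<dots> = (\<Sum>t<d. 17 ^ t)"
    by (rule sum.reindex_bij_witness[of _ "\<lambda>i. d - i" "\<lambda>i. d - i"]) auto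
  also have "\<dots> = (17 ^ d - 1) / 16"
    by (simp add: sum_gp_strict field_simps)
  finally show ?thesis using True by (simp add: moment_growth_def)
next
  case False
  have le: "moment_growth e \<le> 17 ^ 128" for e
    unfolding moment_growth_def by (intro power_increasing) auto
  have "{1..d} = insert d {1..<d}" using False by auto
  then have "(\<Sum>t=1..d. moment_growth (d - t) / (d choose t)) = 1 + (\<Sum>t=1..<d. moment_growth (d - t) / (d choose t))"
    by (simp add: moment_growth_def)
  also have "(\<Sum>t=1..<d. moment_growth (d - t) / (d choose t)) \<le> (\<Sum>t=1..<d. 17 ^ 128 * (1 / (d choose t)))"
    using le by (intro sum_mono) (auto intro!: divide_right_mono)
  also have "\<dots> \<le> 17 ^ 128 * (4 / d)"
    unfolding sum_distrib_left[symmetric] by (intro mult_left_mono sum_inverse_choose_le) auto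
  also have "\<dots> \<le> 17 ^ 128 * (4 / 128)"
    using False by (intro mult_left_mono divide_left_mono) auto
  finally show ?thesis using False by (simp add: moment_growth_def)
qed

text \<open>The square root of the ceiling \<open>17 ^ 128\<close> of
  \<open>moment_growth\<close>.\<close>

definition moment_const :: real where "moment_const = 17 ^ 64"

lemma moment_const_ge_1: "moment_const \<ge> 1"
  by (simp add: moment_const_def)

text \<open>Summing over tuples weighs the squared coefficient of each monomial by the inverse of
  its multinomial coefficient. This damping is the source of the factors
  \<open>1 / (d choose t)\<close> in the recursion, and so of a constant that does not grow with
  \<open>d\<close>.\<close>

lemma sum_norm_sq_le:
  assumes "finite J" "2 * d < N" "symm_on d J e"
  shows "(\<Sum>l\<in>tup d J. (norm (e l))\<^sup>2) \<le> (moment_const * sample_mean N J (\<lambda>z. norm (form_val d J e z)))\<^sup>2"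
proof -
  have "(\<Sum>l\<in>tup d J. (norm (e l))\<^sup>2) \<le> moment_growth d * (sample_mean N J (\<lambda>z. norm (form_val d J e z)))\<^sup>2"
    using assms by (intro sum_norm_sq_le_sample_mean[where G = moment_growth] moment_growth_rec) (auto simp: moment_growth_def)
  also have "\<dots> \<le> 17 ^ 128 * (sample_mean N J (\<lambda>z. norm (form_val d J e z)))\<^sup>2"
    unfolding moment_growth_def by (intro mult_right_mono power_increasing) auto
  finally show ?thesis by (simp add: moment_const_def power_mult_distrib flip: power_mult)
qed

section \<open>Off-diagonal coefficients on the polydisc\<close>

definition off_diag :: "'a list \<Rightarrow> bool" where
  "off_diag xs \<longleftrightarrow> (\<forall>k. \<not> set xs \<subseteq> {k})"

text \<open>An upper bound instead of a supremum, so that restricting or rescaling a form needs no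
  boundedness or attainment argument.\<close>

definition disc_bound :: "nat \<Rightarrow> 'a set \<Rightarrow> ('a list \<Rightarrow> complex) \<Rightarrow> real \<Rightarrow> bool" where
  "disc_bound m I c M \<longleftrightarrow> (\<forall>y. (\<forall>i\<in>I. norm (y i) \<le> 1) \<longrightarrow> norm (form_val m I c y) \<le> M)"

lemma disc_bound_nonneg:
  assumes "disc_bound m I c M"
  shows "M \<ge> 0"
proof -
  have "norm (form_val m I c (\<lambda>_. 0)) \<le> M" using assms by (simp add: disc_bound_def)
  then show ?thesis by (rule order_trans[OF norm_ge_zero])
qed

text \<open>The coefficient of the \<open>t\<close>-th power of variable \<open>k\<close>: setting
  that variable to 1 strips its factor from each selected monomial.\<close>

lemma sum_count_eq_form_val:
  fixes c :: "'a list \<Rightarrow> complex"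
  assumes "finite I" "k \<in> I" "symm_on m I c" "t \<le> m"
  shows "(\<Sum>xs\<in>tup m I. if count_list xs k = t then c xs * mprod (z(k := 1)) xs else 0)
    = of_nat (m choose t) * form_val (m - t) (I - {k}) (\<lambda>l. c (replicate t k @ l)) z"
proof -
  let ?J = "I - {k}"
  let ?F = "\<lambda>xs. if count_list xs k = t then c xs * mprod (z(k := 1)) xs else 0"
  have I: "insert k ?J = I" using assms by auto
  have sF: "symm_on m I ?F"
    unfolding symm_on_def
  proof (intro ballI allI impI)
    fix xs ys assume xs: "xs \<in> tup m I" "mset xs = mset ys"
    then have "count_list xs k = count_list ys k" by (metis count_mset)
    then show "?F xs = ?F ys"
      using symm_onD[OF assms(3) xs] mprod_mset[OF xs(2), of "z(k := 1)"] by simp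
  qed
  have "(\<Sum>xs\<in>tup m I. ?F xs) = (\<Sum>s\<le>m. of_nat (m choose s) * (\<Sum>l\<in>tup (m - s) ?J. ?F (replicate s k @ l)))"
    using sum_tup_split[of ?J k m ?F] assms(1) sF unfolding I by simp
  also have "\<dots> = (\<Sum>s\<le>m. if s = t then of_nat (m choose t) * form_val (m - t) ?J (\<lambda>l. c (replicate t k @ l)) z else 0)"
  proof (intro sum.cong refl)
    fix s
    have *: "?F (replicate s k @ l) = (if s = t then c (replicate t k @ l) * mprod z l else 0)"
      if "l \<in> tup (m - s) ?J" for l
    proof -
      have "k \<notin> set l" using that by (auto simp: tup_def)
      then have "count_list l k = 0" "mprod (z(k := 1)) l = mprod z l"
        by (auto intro!: mprod_cong simp: count_list_0_iff)
      moreover have "count_list (replicate s k) k = s" by (induction s) auto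
      ultimately show ?thesis by simp
    qed
    show "of_nat (m choose s) * (\<Sum>l\<in>tup (m - s) ?J. ?F (replicate s k @ l)) =
      (if s = t then of_nat (m choose t) * form_val (m - t) ?J (\<lambda>l. c (replicate t k @ l)) z else 0)"
      using * by (simp add: form_val_def)
  qed
  finally show ?thesis using assms by simp
qed

text \<open>The average selects the monomials whose exponents on \<open>B\<close> are all divisible by \<open>t\<close> and add up
  to \<open>t\<close>, i.e. those with a single variable of \<open>B\<close>, to the power \<open>t\<close>.\<close>

lemma mprod_root_average:
  fixes z u :: "'a \<Rightarrow> complex"
  assumes fin: "finite I" and B: "B = {k \<in> I. z k = 0}" and t: "1 \<le> t" "t \<le> m" and N: "m < N"
    and xs: "xs \<in> tup m I"
  defines "y \<equiv> \<lambda>r g i. if i \<in> B then unity_root N r * unity_root t (g i) * u i else z i"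
  shows "(\<Sum>r<N. \<Sum>g\<in>B \<rightarrow>\<^sub>E {..<t}. unity_root N r ^ (N - t) * mprod (y r g) xs) =
     of_nat N * of_nat t ^ card B * (\<Sum>k\<in>B. u k ^ t * (if count_list xs k = t then mprod (z(k := 1)) xs else 0))"
proof -
  let ?n = "count_list xs"
  define s where "s = (\<Sum>i\<in>B. ?n i)"
  define A where "A = (\<Prod>i\<in>I - B. z i ^ ?n i)"
  define U where "U = (\<Prod>i\<in>B. u i ^ ?n i)"
  have BI: "B \<subseteq> I" "finite B" using fin B by auto
  have xI: "set xs \<subseteq> I" and len: "length xs = m" using xs by (auto simp: tup_def)
  have "s \<le> (\<Sum>i\<in>I. ?n i)" unfolding s_def using fin BI by (intro sum_mono2) auto
  also have "\<dots> = m"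
    using sum_count_set[of xs I] xI fin len by simp
  finally have s: "s \<le> m" .
  have my: "mprod (y r g) xs = A * (unity_root N r ^ s * (\<Prod>i\<in>B. unity_root t (g i) ^ ?n i) * U)" for r g
  proof -
    have "mprod (y r g) xs = (\<Prod>i\<in>I - B. y r g i ^ ?n i) * (\<Prod>i\<in>B. y r g i ^ ?n i)"
      using mprod_count[OF fin xI] prod.subset_diff[OF BI(1) fin] by metis
    also have "(\<Prod>i\<in>I - B. y r g i ^ ?n i) = A"
      unfolding A_def by (intro prod.cong) (auto simp: y_def)
    also have "(\<Prod>i\<in>B. y r g i ^ ?n i) = (\<Prod>i\<in>B. unity_root N r ^ ?n i * unity_root t (g i) ^ ?n i * u i ^ ?n i)"
      by (intro prod.cong) (auto simp: y_def power_mult_distrib)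
    also have "\<dots> = unity_root N r ^ s * (\<Prod>i\<in>B. unity_root t (g i) ^ ?n i) * U"
      by (simp add: prod.distrib U_def s_def power_sum)
    finally show ?thesis .
  qed
  have pg: "(\<Sum>g\<in>B \<rightarrow>\<^sub>E {..<t}. \<Prod>i\<in>B. unity_root t (g i) ^ ?n i) = (\<Prod>i\<in>B. if t dvd ?n i then of_nat t else 0)"
    using t BI(2) by (subst prod_sum_PiE[symmetric]) (auto simp: sum_unity_root_power)
  have pr: "(\<Sum>r<N. unity_root N r ^ (N - t + s)) = (if s = t then of_nat N else 0)"
  proof -
    have "N dvd N - t + s \<longleftrightarrow> s = t"
    proof
      assume "N dvd N - t + s"
      then obtain q where q: "N - t + s = N * q" by auto
      have "0 < N * q" "N * q < N * 2" using q t N s by linarith+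
      then have "q = 1" by simp
      then show "s = t" using q t N by simp
    qed (use t N in auto)
    then show ?thesis using N by (simp add: sum_unity_root_power)
  qed
  have "(\<Sum>r<N. \<Sum>g\<in>B \<rightarrow>\<^sub>E {..<t}. unity_root N r ^ (N - t) * mprod (y r g) xs) =
     (\<Sum>r<N. unity_root N r ^ (N - t + s)) * (\<Sum>g\<in>B \<rightarrow>\<^sub>E {..<t}. \<Prod>i\<in>B. unity_root t (g i) ^ ?n i) * (A * U)"
    unfolding my sum_distrib_left sum_distrib_right power_add by (subst sum.swap) (simp add: mult_ac)
  also have "\<dots> = (if s = t then of_nat N else 0) * (\<Prod>i\<in>B. if t dvd ?n i then of_nat t else 0) * (A * U)"
    by (simp only: pr pg)
  also have "\<dots> = of_nat N * of_nat t ^ card B * (\<Sum>k\<in>B. u k ^ t * (if ?n k = t then mprod (z(k := 1)) xs else 0))"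
  proof -
    \<comment> \<open>\<open>z\<close> vanishes on \<open>B\<close> and \<open>0 ^ 0 = 1\<close>, so
      the product over \<open>B - {k}\<close> is the indicator that no other variable of
      \<open>B\<close> occurs in \<open>xs\<close>.\<close>
    have mz: "mprod (z(k := 1)) xs = A * (\<Prod>i\<in>B - {k}. 0 ^ ?n i)" if "k \<in> B" for k
    proof -
      have "mprod (z(k := 1)) xs = (\<Prod>i\<in>I - B. (z(k := 1)) i ^ ?n i) * (\<Prod>i\<in>B. (z(k := 1)) i ^ ?n i)"
        using mprod_count[OF fin xI] prod.subset_diff[OF BI(1) fin] by metis
      also have "(\<Prod>i\<in>I - B. (z(k := 1)) i ^ ?n i) = A"
        unfolding A_def using that by (intro prod.cong) auto
      also have "(\<Prod>i\<in>B. (z(k := 1)) i ^ ?n i) = (\<Prod>i\<in>B - {k}. (z(k := 1)) i ^ ?n i)"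
        using prod.remove[OF BI(2) that, of "\<lambda>i. (z(k := 1)) i ^ ?n i"] by simp
      also have "\<dots> = (\<Prod>i\<in>B - {k}. 0 ^ ?n i)"
        using B by (intro prod.cong) auto
      finally show ?thesis .
    qed
    have other: "s = t + (\<Sum>i\<in>B - {k}. ?n i)" if "k \<in> B" "?n k = t" for k
      using that sum.remove[OF BI(2) that(1), of ?n] by (simp add: s_def)
    show ?thesis
    proof (cases "s = t \<and> (\<forall>i\<in>B. t dvd ?n i)")
      case True
      have "\<exists>k\<in>B. ?n k \<noteq> 0"
        using True t unfolding s_def by (metis not_one_le_zero sum.neutral)
      then obtain k where k: "k \<in> B" "?n k > 0" by auto
      have "?n k \<le> s" unfolding s_def using BI k by (intro member_le_sum) auto
      moreover have "t \<le> ?n k" using True k by (auto dest: dvd_imp_le)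
      ultimately have nk: "?n k = t" using True by simp
      then have "(\<Sum>i\<in>B - {k}. ?n i) = 0" using other[OF k(1)] True by simp
      then have n0: "?n i = 0" if "i \<in> B" "i \<noteq> k" for i
        using that BI by (auto simp: sum_eq_0_iff)
      have "(\<Sum>k\<in>B. u k ^ t * (if ?n k = t then mprod (z(k := 1)) xs else 0)) =
          (\<Sum>i\<in>B. if i = k then u k ^ t * mprod (z(k := 1)) xs else 0)"
        using n0 nk t by (intro sum.cong) auto
      also have "\<dots> = u k ^ t * A"
        using k BI n0 mz[OF k(1)] by simp
      also have "u k ^ t = U"
        using prod.remove[OF BI(2) k(1), of "\<lambda>i. u i ^ ?n i"] n0 nk by (simp add: U_def)
      finally show ?thesis using True by simp
    next
      case False
      have "(if ?n k = t then mprod (z(k := 1)) xs else 0) = 0" if k: "k \<in> B" for k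
      proof (cases "?n k = t")
        case True
        have "\<exists>i\<in>B - {k}. ?n i \<noteq> 0"
        proof (rule ccontr)
          assume "\<not> ?thesis"
          then have "s = t" "\<forall>i\<in>B. t dvd ?n i"
            using other[OF k True] True by (simp, metis DiffI dvd_0_right dvd_refl singletonD)
          then show False using False by simp
        qed
        then have "(\<Prod>i\<in>B - {k}. (0::complex) ^ ?n i) = 0"
          using BI by (intro prod_zero) auto
        then show ?thesis using mz[OF k] by simp
      qed simp
      moreover have "(if s = t then of_nat N else 0) * (\<Prod>i\<in>B. if t dvd ?n i then of_nat t else 0) = (0::complex)"
        using False BI by (auto intro!: prod_zero)
      ultimately show ?thesis by simp
    qed
  qed
  finally show ?thesis .
qed

text \<open>The coefficients of the \<open>t\<close>-th powers of all vanishing variables are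
  controlled at once: the root-of-unity average of the form is the sum of
  \<open>u k ^ t * F k\<close>, and every averaged point stays in the polydisc.\<close>

lemma sum_norm_coeff_le:
  fixes c :: "'a list \<Rightarrow> complex"
  assumes fin: "finite I" and sym: "symm_on m I c" and M: "disc_bound m I c M"
    and t: "1 \<le> t" "t \<le> m" and z: "\<And>i. i \<in> I \<Longrightarrow> norm (z i) \<le> 1"
  shows "(\<Sum>k | k \<in> I \<and> z k = 0.
     norm (of_nat (m choose t) * form_val (m - t) (I - {k}) (\<lambda>l. c (replicate t k @ l)) z)) \<le> M"
proof -
  define B where "B = {k \<in> I. z k = 0}"
  define F where "F k = of_nat (m choose t) * form_val (m - t) (I - {k}) (\<lambda>l. c (replicate t k @ l)) z" for k
  \<comment> \<open>A \<open>t\<close>-th root of the conjugate phase of \<open>F k\<close>; its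
    \<open>t\<close>-th power turns \<open>F k\<close> into \<open>norm (F k)\<close>.\<close>
  define u where "u k = cis (- Arg (F k) / t)" for k
  define N where "N = Suc m"
  let ?G = "B \<rightarrow>\<^sub>E {..<t}"
  define y where "y = (\<lambda>r g i. if i \<in> B then unity_root N r * unity_root t (g i) * u i else z i)"
  have BI: "finite B" "\<And>k. k \<in> B \<Longrightarrow> k \<in> I" using fin by (auto simp: B_def)
  have u: "u k ^ t * F k = norm (F k)" for k
  proof -
    have "u k ^ t = cis (- Arg (F k))" using t by (simp add: u_def Complex.DeMoivre)
    also have "\<dots> * (norm (F k) * cis (Arg (F k))) = norm (F k)"
      by (simp add: cis_mult mult.left_commute)
    also have "norm (F k) * cis (Arg (F k)) = F k"
      using rcis_cmod_Arg[of "F k"] by (simp add: rcis_def)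
    finally show ?thesis .
  qed
  have "(\<Sum>r<N. \<Sum>g\<in>?G. unity_root N r ^ (N - t) * form_val m I c (y r g)) =
      (\<Sum>xs\<in>tup m I. c xs * (\<Sum>r<N. \<Sum>g\<in>?G. unity_root N r ^ (N - t) * mprod (y r g) xs))"
  proof -
    have "(\<Sum>r<N. \<Sum>g\<in>?G. unity_root N r ^ (N - t) * form_val m I c (y r g)) =
        (\<Sum>r<N. \<Sum>xs\<in>tup m I. \<Sum>g\<in>?G. c xs * (unity_root N r ^ (N - t) * mprod (y r g) xs))"
      unfolding form_val_def sum_distrib_left by (subst (2) sum.swap) (simp add: mult_ac)
    also have "\<dots> = (\<Sum>xs\<in>tup m I. \<Sum>r<N. \<Sum>g\<in>?G. c xs * (unity_root N r ^ (N - t) * mprod (y r g) xs))"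
      by (rule sum.swap)
    finally show ?thesis by (simp add: sum_distrib_left)
  qed
  also have "\<dots> = (\<Sum>xs\<in>tup m I. c xs * (of_nat N * of_nat t ^ card B *
      (\<Sum>k\<in>B. u k ^ t * (if count_list xs k = t then mprod (z(k := 1)) xs else 0))))"
    unfolding y_def using mprod_root_average[OF fin B_def t, of N] by (intro sum.cong) (auto simp: N_def)
  also have "\<dots> = (\<Sum>xs\<in>tup m I. \<Sum>k\<in>B. of_nat N * of_nat t ^ card B * (u k ^ t *
      (if count_list xs k = t then c xs * mprod (z(k := 1)) xs else 0)))"
    unfolding sum_distrib_left by (intro sum.cong) auto
  also have "\<dots> = (\<Sum>k\<in>B. \<Sum>xs\<in>tup m I. of_nat N * of_nat t ^ card B * (u k ^ t *
      (if count_list xs k = t then c xs * mprod (z(k := 1)) xs else 0)))"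
    by (rule sum.swap)
  also have "\<dots> = (\<Sum>k\<in>B. of_nat N * of_nat t ^ card B * (u k ^ t * F k))"
  proof (intro sum.cong refl)
    fix k assume "k \<in> B"
    then show "(\<Sum>xs\<in>tup m I. of_nat N * of_nat t ^ card B * (u k ^ t *
      (if count_list xs k = t then c xs * mprod (z(k := 1)) xs else 0)))
      = of_nat N * of_nat t ^ card B * (u k ^ t * F k)"
      by (simp only: sum_distrib_left[symmetric] sum_count_eq_form_val[OF fin BI(2) sym t(2)] F_def)
  qed
  also have "\<dots> = of_real (N * real t ^ card B * (\<Sum>k\<in>B. norm (F k)))"
    by (simp add: u sum_distrib_left)
  finally have "N * real t ^ card B * (\<Sum>k\<in>B. norm (F k)) =
      norm (\<Sum>r<N. \<Sum>g\<in>?G. unity_root N r ^ (N - t) * form_val m I c (y r g))"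
    by (simp add: norm_mult norm_power sum_nonneg del: of_real_sum)
  also have "\<dots> \<le> (\<Sum>r<N. \<Sum>g\<in>?G. M)"
  proof (intro order_trans[OF norm_sum] sum_mono)
    fix r g
    have "norm (y r g i) \<le> 1" if "i \<in> I" for i
      using z[OF that] by (simp add: y_def norm_mult u_def)
    then have "norm (form_val m I c (y r g)) \<le> M" using M by (simp add: disc_bound_def)
    then show "norm (unity_root N r ^ (N - t) * form_val m I c (y r g)) \<le> M"
      by (simp add: norm_mult norm_power)
  qed
  also have "\<dots> = N * real t ^ card B * M"
    using BI by (simp add: card_PiE)
  finally have "(\<Sum>k\<in>B. norm (F k)) \<le> M"
    using t by (simp add: N_def)
  then show ?thesis by (simp add: B_def F_def)
qed

text \<open>The preceding bound is averaged over random \<open>z\<close>. Variable \<open>k\<close>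
  vanishes with probability 1/2, independently of \<open>f k\<close>, which does not involve it;
  this gives the factor 2. The first moments then dominate the \<open>\<ell>\<close>2 sums up to
  \<open>moment_const\<close>.\<close>

lemma sum_sqrt_coeff_le:
  fixes c :: "'a list \<Rightarrow> complex"
  assumes fin: "finite I" and sym: "symm_on m I c" and M: "disc_bound m I c M"
    and t: "1 \<le> t" "t \<le> m"
  shows "(\<Sum>k\<in>I. sqrt (\<Sum>l\<in>tup (m - t) (I - {k}). (norm (c (replicate t k @ l)))\<^sup>2))
    \<le> 2 * moment_const * M / (m choose t)"
proof -
  define N where "N = Suc (2 * m)"
  define f where "f k = form_val (m - t) (I - {k}) (\<lambda>l. c (replicate t k @ l))" for k
  define X where "X k = sample_mean N (I - {k}) (\<lambda>z. norm (f k z))" for k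
  have C: "real (m choose t) > 0" using t by simp
  have Ex: "sample_mean N I (\<lambda>z. if z k = 0 then norm (of_nat (m choose t) * f k z) else 0)
      = real (m choose t) * X k / 2" if k: "k \<in> I" for k
  proof -
    have fk: "f k (z(k := w)) = f k z" for z w
      unfolding f_def form_val_def
      by (intro sum.cong refl arg_cong2[of _ _ _ _ "(*)"] mprod_cong) (auto simp: tup_def)
    have I: "insert k (I - {k}) = I" using k by auto
    have "sample_mean N (insert k (I - {k})) (\<lambda>z. if z k = 0 then norm (of_nat (m choose t) * f k z) else 0)
        = (\<Sum>r\<le>N. sample_wt N r * (if sample_pt N r = 0 then real (m choose t) * X k else 0))"
      using fin by (subst sample_mean_insert)
        (auto simp: fk X_def norm_mult sample_mean_cmult sample_mean_const N_def intro!: sum.cong)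
    also have "\<dots> = real (m choose t) * X k / 2"
      using sum_sample_wt[of N "\<lambda>w. if w = 0 then real (m choose t) * X k else 0"] by (simp add: N_def)
    finally show ?thesis by (simp only: I)
  qed
  have "real (m choose t) * (\<Sum>k\<in>I. X k) / 2 =
      sample_mean N I (\<lambda>z. \<Sum>k\<in>I. if z k = 0 then norm (of_nat (m choose t) * f k z) else 0)"
    by (simp add: sample_mean_sum Ex sum_distrib_left sum_divide_distrib)
  also have "\<dots> \<le> sample_mean N I (\<lambda>z. M)"
  proof (rule sample_mean_mono)
    fix z :: "'a \<Rightarrow> complex" assume z: "\<And>i. i \<in> I \<Longrightarrow> norm (z i) \<le> 1"
    have "(\<Sum>k\<in>I. if z k = 0 then norm (of_nat (m choose t) * f k z) else 0) =
        (\<Sum>k | k \<in> I \<and> z k = 0. norm (of_nat (m choose t) * f k z))"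
      using fin by (simp add: sum.inter_filter)
    then show "(\<Sum>k\<in>I. if z k = 0 then norm (of_nat (m choose t) * f k z) else 0) \<le> M"
      unfolding f_def using sum_norm_coeff_le[OF fin sym M t z] by simp
  qed
  also have "\<dots> = M" using fin by (simp add: sample_mean_const N_def)
  finally have X: "(\<Sum>k\<in>I. X k) \<le> 2 * M / (m choose t)"
    using C by (simp add: field_simps)
  have "(\<Sum>k\<in>I. sqrt (\<Sum>l\<in>tup (m - t) (I - {k}). (norm (c (replicate t k @ l)))\<^sup>2)) \<le> (\<Sum>k\<in>I. moment_const * X k)"
  proof (rule sum_mono)
    fix k assume k: "k \<in> I"
    have "(\<Sum>l\<in>tup (m - t) (I - {k}). (norm (c (replicate t k @ l)))\<^sup>2) \<le> (moment_const * X k)\<^sup>2"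
      unfolding X_def f_def using fin k t sym
      by (intro sum_norm_sq_le symm_on_replicate_append[of m I]) (auto simp: N_def)
    then show "sqrt (\<Sum>l\<in>tup (m - t) (I - {k}). (norm (c (replicate t k @ l)))\<^sup>2) \<le> moment_const * X k"
      using moment_const_ge_1 by (intro real_le_lsqrt mult_nonneg_nonneg) (auto simp: X_def intro!: sample_mean_nonneg sum_nonneg)
  qed
  also have "\<dots> \<le> moment_const * (2 * M / (m choose t))"
    unfolding sum_distrib_left[symmetric] using X moment_const_ge_1 by (intro mult_left_mono) auto
  finally show ?thesis by (simp add: mult_ac)
qed

text \<open>For \<open>m \<ge> 6\<close> the terms at distance 1 from the ends give
  \<open>2 / sqrt m\<close>, those at distance 2 at most \<open>4 / sqrt m\<close>, and the fewer
  than \<open>m\<close> others are at most \<open>4 / (m * sqrt m)\<close> each, because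
  \<open>m choose 3\<close> is at least \<open>m ^ 3 / 16\<close>.\<close>

lemma sum_inverse_sqrt_choose_le: "(\<Sum>t=1..<m. 1 / sqrt (m choose t)) \<le> 10 / sqrt m"
proof (cases "m < 6")
  case True
  have "(\<Sum>t=1..<m. 1 / sqrt (m choose t)) \<le> (\<Sum>t=1..<m. 1 / sqrt m)"
  proof (intro sum_mono divide_left_mono)
    fix t assume t: "t \<in> {1..<m}"
    then show "sqrt m \<le> sqrt (m choose t)" using choose_ge_self by simp
    show "0 < sqrt (m choose t) * sqrt m" using t by (auto intro!: mult_pos_pos)
  qed auto
  also have "\<dots> = real (m - 1) * (1 / sqrt m)" by simp
  also have "\<dots> \<le> 10 * (1 / sqrt m)" using True by (intro mult_right_mono) auto
  finally show ?thesis by simp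
next
  case False
  then have m: "m \<ge> 6" by simp
  define g where "g t = 1 / sqrt (m choose t)" for t
  have sym: "g (m - r) = g r" if "r \<le> m" for r
    using binomial_symmetric[OF that] by (simp add: g_def)
  have "{1..<m} = {1, 2, m - 2, m - 1} \<union> {3..<m - 2}" using m by auto
  then have "(\<Sum>t=1..<m. g t) = (\<Sum>t\<in>{1, 2, m - 2, m - 1}. g t) + (\<Sum>t=3..<m - 2. g t)"
    using m by (simp only:) (rule sum.union_disjoint, auto)
  also have "(\<Sum>t\<in>{1, 2, m - 2, m - 1}. g t) = 2 * g 1 + 2 * g 2"
  proof -
    have "Suc 0 \<noteq> m - 2" "Suc 0 \<noteq> m - Suc 0" "2 \<noteq> m - 2" "2 \<noteq> m - Suc 0" "m - 2 \<noteq> m - Suc 0"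
      using m by auto
    then show ?thesis using m sym[of 1] sym[of 2] by simp
  qed
  also have "g 1 = 1 / sqrt m" by (simp add: g_def)
  also have "g 2 \<le> 2 / m"
  proof -
    have "real m ^ 2 \<le> 4 * (m choose 2)"
      using m by (simp add: choose_two real_of_nat_div of_nat_diff power2_eq_square) 
    then have "real m / 2 \<le> sqrt (m choose 2)"
      by (intro real_le_rsqrt) (simp add: power_divide)
    then have "1 / sqrt (m choose 2) \<le> 1 / (real m / 2)"
      using m by (intro divide_left_mono) auto
    then show ?thesis by (simp add: g_def)
  qed
  also have "(\<Sum>t=3..<m - 2. g t) \<le> (\<Sum>t=3..<m - 2. 4 / (real m * sqrt m))"
  proof (rule sum_mono)
    fix t assume t: "t \<in> {3..<m - 2}"
    have c3: "6 * real (m choose 3) = real m * (real m - 1) * (real m - 2)"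
      using binomial_gbinomial[of m 3, where 'a = real]
      by (simp add: gbinomial_prod_rev numeral_3_eq_3 fact_numeral lessThan_Suc atLeast0_lessThan_Suc mult_ac)
    have "real m ^ 3 / 16 \<le> real (m choose 3)"
    proof -
      have "3 * (real m * real m) \<le> 8 * ((real m - 1) * (real m - 2))"
      proof -
        have "0 \<le> (real m - 6) * (5 * real m + 6) + 52" using m by simp
        then show ?thesis by (simp add: algebra_simps)
      qed
      then have "real m * (3 * (real m * real m)) \<le> real m * (8 * ((real m - 1) * (real m - 2)))"
        by (intro mult_left_mono) auto
      then show ?thesis using c3 by (simp add: power3_eq_cube algebra_simps)
    qed
    also have "real (m choose 3) \<le> real (m choose t)"
      using t by (intro of_nat_mono choose_ge_choose) auto
    finally have "sqrt (real m ^ 3 / 16) \<le> sqrt (m choose t)" by simp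
    moreover have "sqrt (real m ^ 3 / 16) = real m * sqrt m / 4"
      by (simp add: real_sqrt_divide power3_eq_cube real_sqrt_mult)
    ultimately have "1 / sqrt (m choose t) \<le> 1 / (real m * sqrt m / 4)"
      using m t by (intro divide_left_mono mult_pos_pos) auto
    then show "g t \<le> 4 / (real m * sqrt m)" by (simp add: g_def)
  qed
  also have "\<dots> \<le> real m * (4 / (real m * sqrt m))"
    using m by (simp only: sum_constant) (intro mult_right_mono, auto)
  also have "\<dots> = 4 / sqrt m" using m by simp
  also have "2 / real m \<le> 2 / sqrt m"
  proof (intro divide_left_mono)
    show "sqrt m \<le> m" using m by (intro real_le_lsqrt) (auto simp: power2_eq_square)
  qed (use m in auto)
  finally show ?thesis unfolding g_def by simp
qed

text \<open>Tuples are grouped by the multiplicity \<open>t\<close> of \<open>k\<close>; the largest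
  multiplicity is the diagonal and drops out. Group \<open>t\<close> carries the root of the
  binomial coefficient and is bounded by its inverse, which leaves the sum of inverse roots.\<close>

lemma sum_sqrt_off_diag_le:
  fixes c :: "'a list \<Rightarrow> complex"
  assumes fin: "finite I" and sym: "symm_on (Suc m) I c" and M: "disc_bound (Suc m) I c M"
  shows "(\<Sum>k\<in>I. sqrt (\<Sum>l\<in>tup m I. if off_diag (k # l) then (norm (c (k # l)))\<^sup>2 else 0))
    \<le> 20 * moment_const * M / sqrt (Suc m)"
proof -
  define S where "S k t = (\<Sum>l\<in>tup (Suc m - t) (I - {k}). (norm (c (replicate t k @ l)))\<^sup>2)" for k t
  have M0: "M \<ge> 0"
    using M by (rule disc_bound_nonneg)
  have S0: "S k t \<ge> 0" for k t by (simp add: S_def sum_nonneg)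
  have inner: "sqrt (\<Sum>l\<in>tup m I. if off_diag (k # l) then (norm (c (k # l)))\<^sup>2 else 0)
      \<le> (\<Sum>t=1..<Suc m. sqrt (Suc m choose t) * sqrt (S k t))" if k: "k \<in> I" for k
  proof -
    let ?F = "\<lambda>l. if off_diag (k # l) then (norm (c (k # l)))\<^sup>2 else 0"
    have I: "insert k (I - {k}) = I" using k by auto
    have sF: "symm_on m I ?F"
      unfolding symm_on_def
    proof (intro ballI allI impI)
      fix xs ys assume xs: "xs \<in> tup m I" "mset xs = mset ys"
      then have "set xs = set ys" by (metis set_mset_mset)
      moreover have "c (k # xs) = c (k # ys)"
        by (rule symm_onD[OF sym]) (use xs k in \<open>auto simp: tup_def\<close>)
      ultimately show "?F xs = ?F ys" by (simp add: off_diag_def)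
    qed
    have "(\<Sum>l\<in>tup m I. ?F l) = (\<Sum>t\<le>m. real (m choose t) * (\<Sum>l\<in>tup (m - t) (I - {k}). ?F (replicate t k @ l)))"
      using sum_tup_split[of "I - {k}" k m ?F] fin sF unfolding I by simp
    also have "\<dots> = (\<Sum>t<m. real (m choose t) * (\<Sum>l\<in>tup (m - t) (I - {k}). ?F (replicate t k @ l)))"
    proof -
      have "\<not> off_diag (k # replicate m k)" by (auto simp: off_diag_def)
      then show ?thesis by (simp flip: lessThan_Suc_atMost)
    qed
    also have "\<dots> = (\<Sum>t<m. real (m choose t) * S k (Suc t))"
    proof (intro sum.cong refl arg_cong2[of _ _ _ _ "(*)"])
      fix t assume t: "t \<in> {..<m}"
      have "off_diag (k # replicate t k @ l)" if "l \<in> tup (m - t) (I - {k})" for l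
      proof -
        have "l \<noteq> []" "k \<notin> set l" using that t by (auto simp: tup_def)
        then have "hd l \<in> set l" "hd l \<noteq> k" using hd_in_set[of l] by metis+
        then show ?thesis by (auto simp: off_diag_def)
      qed
      then show "(\<Sum>l\<in>tup (m - t) (I - {k}). ?F (replicate t k @ l)) = S k (Suc t)"
        by (simp add: S_def)
    qed
    \<comment> \<open>The leading \<open>k\<close> is fixed, so \<open>t\<close> further copies mean
      multiplicity \<open>Suc t\<close>; enlarging the binomial coefficient matches it to the bound
      for that group.\<close>
    also have "\<dots> \<le> (\<Sum>t<m. real (Suc m choose Suc t) * S k (Suc t))"
      using S0 by (intro sum_mono mult_right_mono) auto
    also have "\<dots> = (\<Sum>t=1..<Suc m. (sqrt (Suc m choose t) * sqrt (S k t))\<^sup>2)"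
      using S0 by (intro sum.reindex_bij_witness[of _ "\<lambda>t. t - 1" Suc]) (auto simp: power_mult_distrib)
    finally have "sqrt (\<Sum>l\<in>tup m I. ?F l) \<le> L2_set (\<lambda>t. sqrt (Suc m choose t) * sqrt (S k t)) {1..<Suc m}"
      by (simp add: L2_set_def)
    also have "\<dots> \<le> (\<Sum>t=1..<Suc m. sqrt (Suc m choose t) * sqrt (S k t))"
      using S0 by (intro L2_set_le_sum) auto
    finally show ?thesis .
  qed
  have "(\<Sum>k\<in>I. sqrt (\<Sum>l\<in>tup m I. if off_diag (k # l) then (norm (c (k # l)))\<^sup>2 else 0))
      \<le> (\<Sum>k\<in>I. \<Sum>t=1..<Suc m. sqrt (Suc m choose t) * sqrt (S k t))"
    by (intro sum_mono inner)
  also have "\<dots> = (\<Sum>t=1..<Suc m. sqrt (Suc m choose t) * (\<Sum>k\<in>I. sqrt (S k t)))"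
    by (subst sum.swap) (simp add: sum_distrib_left)
  also have "\<dots> \<le> (\<Sum>t=1..<Suc m. 2 * moment_const * M * (1 / sqrt (Suc m choose t)))"
  proof (rule sum_mono)
    fix t assume t: "t \<in> {1..<Suc m}"
    then have C: "real (Suc m choose t) > 0" by simp
    have "sqrt (Suc m choose t) * (\<Sum>k\<in>I. sqrt (S k t)) \<le> sqrt (Suc m choose t) * (2 * moment_const * M / (Suc m choose t))"
      unfolding S_def using t by (intro mult_left_mono sum_sqrt_coeff_le[OF fin sym M]) auto
    also have "\<dots> = 2 * moment_const * M * (sqrt (Suc m choose t) / (Suc m choose t))"
      by simp
    also have "sqrt (Suc m choose t) / (Suc m choose t) = 1 / sqrt (Suc m choose t)"
      using C by (simp only: sqrt_divide_self_eq less_imp_le inverse_eq_divide)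
    finally show "sqrt (Suc m choose t) * (\<Sum>k\<in>I. sqrt (S k t)) \<le> 2 * moment_const * M * (1 / sqrt (Suc m choose t))" .
  qed
  also have "\<dots> = 2 * moment_const * M * (\<Sum>t=1..<Suc m. 1 / sqrt (Suc m choose t))"
    by (simp only: sum_distrib_left)
  also have "\<dots> \<le> 2 * moment_const * M * (10 / sqrt (Suc m))"
    using M0 moment_const_ge_1 by (intro mult_left_mono[OF sum_inverse_sqrt_choose_le] mult_nonneg_nonneg) auto
  also have "\<dots> = 20 * moment_const * M / sqrt (Suc m)"
    by (simp only: times_divide_eq_right mult_ac)
  finally show ?thesis .
qed

section \<open>Bounds on the unit ball of the sequence space\<close>

lemma mprod_nonneg: "(\<And>i. (x i :: real) \<ge> 0) \<Longrightarrow> mprod x xs \<ge> 0"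
  by (induction xs) auto

lemma mprod_pos: "(\<And>i. i \<in> set xs \<Longrightarrow> (x i :: real) > 0) \<Longrightarrow> mprod x xs > 0"
  by (induction xs) auto

lemma ln_mprod: "(\<And>i. i \<in> set xs \<Longrightarrow> (x i :: real) > 0) \<Longrightarrow> ln (mprod x xs) = sum_list (map (\<lambda>i. ln (x i)) xs)"
  by (induction xs) (auto simp: ln_mult mprod_pos less_imp_neq[symmetric])

lemma sum_tup_mprod:
  fixes d :: "'a \<Rightarrow> real"
  assumes "finite I"
  shows "(\<Sum>xs\<in>tup m I. mprod d xs) = (\<Sum>i\<in>I. d i) ^ m"
proof (induction m)
  case (Suc m)
  then show ?case using assms
    by (simp add: sum_tup_Suc sum_distrib_left[symmetric] sum_distrib_right[symmetric])
qed simp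

text \<open>A rotation brings any position to the front without changing \<open>F\<close>, so all
  \<open>m\<close> positions contribute equally.\<close>

lemma sum_tup_sum_list:
  fixes F :: "'a list \<Rightarrow> real"
  assumes "symm_on m I F"
  shows "(\<Sum>xs\<in>tup m I. F xs * sum_list (map g xs)) = m * (\<Sum>xs\<in>tup m I. F xs * g (hd xs))"
proof -
  have rot: "(\<Sum>xs\<in>tup m I. F xs * g (xs ! r)) = (\<Sum>xs\<in>tup m I. F xs * g (hd xs))" if r: "r < m" for r
  proof (rule sum.reindex_bij_witness[of _ "rotate (m - r)" "rotate r"])
    fix xs assume xs: "xs \<in> tup m I"
    then have l: "length xs = m" by (simp add: tup_def)
    show "rotate (m - r) (rotate r xs) = xs" "rotate r (rotate (m - r) xs) = xs"
      using l r by (auto simp: rotate_rotate rotate_id)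
    show "rotate r xs \<in> tup m I" "rotate (m - r) xs \<in> tup m I" using xs by (auto simp: tup_def)
    have "F xs = F (rotate r xs)" by (rule symm_onD[OF assms xs], subst rotate_drop_take)
        (metis append_take_drop_id mset_append union_commute)
    moreover have "hd (rotate r xs) = xs ! r"
      using l r by (subst hd_rotate_conv_nth) auto
    ultimately show "F (rotate r xs) * g (hd (rotate r xs)) = F xs * g (xs ! r)" by simp
  qed
  have "(\<Sum>xs\<in>tup m I. F xs * sum_list (map g xs)) = (\<Sum>xs\<in>tup m I. \<Sum>r<m. F xs * g (xs ! r))"
    by (intro sum.cong) (auto simp: tup_def sum_list_sum_nth sum_distrib_left lessThan_atLeast0)
  also have "\<dots> = (\<Sum>r<m. \<Sum>xs\<in>tup m I. F xs * g (xs ! r))" by (rule sum.swap)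
  also have "\<dots> = m * (\<Sum>xs\<in>tup m I. F xs * g (hd xs))" using rot by simp
  finally show ?thesis .
qed

text \<open>The pointwise form of Gibbs' inequality; summed, it shows that relative entropy is
  nonnegative.\<close>

lemma gibbs_term:
  assumes "(a::real) > 0" "b > 0"
  shows "a * (ln a - ln b) \<ge> a - b"
proof -
  have "ln (b / a) \<le> b / a - 1" using assms by (intro ln_le_minus_one) auto
  then have "a * (ln b - ln a) \<le> a * (b / a - 1)"
    using assms by (intro mult_left_mono) (auto simp: ln_div)
  also have "\<dots> = b - a" using assms by (simp add: field_simps)
  finally show ?thesis by (simp add: algebra_simps)
qed

text \<open>A Blei-type inequality. The weights are powers of the marginals of the probability
  proportional to \<open>v\<^sup>s\<close>; after Cauchy--Schwarz and \<open>e\<^sup>t \<ge> 1 + t\<close> it reduces to the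
  subadditivity of entropy.\<close>

lemma blei_marginal:
  fixes v :: "'a list \<Rightarrow> real"
  assumes fin: "finite I" and sym: "symm_on (Suc m) I v" and v0: "\<And>xs. v xs \<ge> 0"
    and p: "p \<ge> 2 * real (Suc m)" and s: "s > 0" "1 / s = 1 / 2 + 1 / (2 * real (Suc m)) - 1 / p"
    and Zpos: "(\<Sum>xs\<in>tup (Suc m) I. v xs powr s) > 0"
  shows "\<exists>x. (\<forall>i. x i \<ge> 0) \<and> (\<Sum>i\<in>I. x i powr p) \<le> 1 \<and>
    (\<Sum>xs\<in>tup (Suc m) I. v xs powr s) powr (1 / s)
       \<le> (\<Sum>k\<in>I. x k * sqrt (\<Sum>l\<in>tup m I. (v (k # l) * mprod x l)\<^sup>2))"
proof -
  define Z where "Z = (\<Sum>xs\<in>tup (Suc m) I. v xs powr s)"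
  define \<mu> where "\<mu> xs = v xs powr s / Z" for xs
  define d where "d k = (\<Sum>l\<in>tup m I. \<mu> (k # l))" for k
  \<comment> \<open>The marginal \<open>d\<close> has total mass 1, so \<open>x\<close> lies on the
    unit sphere of \<open>\<ell>\<close>p.\<close>
  define x where "x k = d k powr (1 / p)" for k
  \<comment> \<open>What is left of the exponent \<open>1 / s\<close> once Cauchy-Schwarz has used a
    square root of \<open>\<mu>\<close>. The identity \<open>a(2)\<close> below makes the
    logarithmic terms combine into \<open>a\<close> times a relative entropy.\<close>
  define a where "a = 1 / s - 1 / 2"
  let ?T = "tup (Suc m) I"
  have Z: "Z > 0" using Zpos by (simp add: Z_def)
  have p0: "p > 0" using p by simp
  have \<mu>0: "\<mu> xs \<ge> 0" for xs using Z by (simp add: \<mu>_def)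
  have d0: "d k \<ge> 0" for k using \<mu>0 by (simp add: d_def sum_nonneg)
  have \<mu>sum: "(\<Sum>xs\<in>?T. \<mu> xs) = 1" using Z by (simp add: \<mu>_def Z_def flip: sum_divide_distrib)
  have dsum: "(\<Sum>k\<in>I. d k) = 1" using \<mu>sum fin by (simp add: d_def sum_tup_Suc)
  have a: "a \<ge> 0" "real (Suc m) * a = 1 / 2 - real (Suc m) / p"
  proof -
    show *: "real (Suc m) * a = 1 / 2 - real (Suc m) / p"
    proof -
      have "r * (1 / 2 + 1 / (2 * r) - 1 / p - 1 / 2) = 1 / 2 - r / p" if "r > 0" for r :: real
        using that p0 by (simp add: field_simps)
      from this[of "real (Suc m)"] show ?thesis unfolding a_def s(2) by simp
    qed
    have "real (Suc m) / p \<le> 1 / 2" using p p0 by (simp add: field_simps)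
    then have "0 \<le> real (Suc m) * a" using * by simp
    then show "a \<ge> 0" by (simp add: zero_le_mult_iff)
  qed
  have sym\<mu>: "symm_on (Suc m) I \<mu>"
    using sym unfolding symm_on_def \<mu>_def by metis
  have dpos: "d i > 0" if xs: "xs \<in> ?T" "\<mu> xs > 0" "i \<in> set xs" for xs i
  proof -
    obtain l where l: "mset xs = mset (i # l)"
      using xs(3) by (metis ex_mset insert_DiffM mset.simps(2) set_mset_mset)
    then have "\<mu> xs = \<mu> (i # l)" using symm_onD[OF sym\<mu> xs(1)] by blast
    moreover have "l \<in> tup m I" using tup_mset[OF xs(1) l] by (auto simp: tup_def)
    ultimately show ?thesis unfolding d_def using xs(2) fin \<mu>0
      by (intro sum_pos2[of _ l]) auto
  qed
  \<comment> \<open>On the support of \<open>\<mu>\<close>, \<open>L\<close> is the logarithm of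
    \<open>W\<close>; off it the terms vanish, whatever value \<open>ln 0\<close> has.\<close>
  define L where "L xs = a * ln (\<mu> xs) - ln (d (hd xs)) / 2 + sum_list (map (\<lambda>i. ln (d i)) xs) / p" for xs
  define W where "W xs = \<mu> xs powr a * d (hd xs) powr (- 1 / 2) * mprod x xs" for xs
  have W: "\<mu> xs * (1 + L xs) \<le> \<mu> xs * W xs" if xs: "xs \<in> ?T" for xs
  proof (cases "\<mu> xs > 0")
    case True
    have hd: "hd xs \<in> set xs" using xs by (intro hd_in_set) (auto simp: tup_def)
    have xpos: "x i > 0" if "i \<in> set xs" for i
      using dpos[OF xs True that] by (simp add: x_def)
    have "ln (mprod x xs) = sum_list (map (\<lambda>i. ln (d i) * (1 / p)) xs)"
      using dpos[OF xs True] by (subst ln_mprod[OF xpos]) (auto simp: x_def ln_powr intro!: arg_cong[of _ _ sum_list])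
    also have "\<dots> = sum_list (map (\<lambda>i. ln (d i)) xs) / p"
      by (simp only: sum_list_mult_const) simp
    moreover have mp: "mprod x xs > 0" by (rule mprod_pos) (rule xpos)
    ultimately have "ln (W xs) = L xs"
      unfolding W_def L_def using True dpos[OF xs True hd]
      by (simp add: ln_mult ln_powr)
    moreover have "W xs > 0"
      unfolding W_def using True dpos[OF xs True hd] mp by simp
    ultimately have "1 + L xs \<le> W xs" using ln_le_minus_one[of "W xs"] by simp
    then show ?thesis using True by (intro mult_left_mono) auto
  next
    case False
    then have "\<mu> xs = 0" using \<mu>0[of xs] by simp
    then show ?thesis by simp
  qed
  have "(\<Sum>xs\<in>?T. \<mu> xs * L xs) = a * (\<Sum>xs\<in>?T. \<mu> xs * ln (\<mu> xs)) - (\<Sum>xs\<in>?T. \<mu> xs * ln (d (hd xs))) / 2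
      + (\<Sum>xs\<in>?T. \<mu> xs * sum_list (map (\<lambda>i. ln (d i)) xs)) / p"
    unfolding L_def sum_distrib_left sum_divide_distrib sum_subtractf[symmetric] sum.distrib[symmetric]
    by (intro sum.cong) (auto simp: algebra_simps)
  also have "\<dots> = a * (\<Sum>xs\<in>?T. \<mu> xs * ln (\<mu> xs)) - (1 / 2 - real (Suc m) / p) * (\<Sum>xs\<in>?T. \<mu> xs * ln (d (hd xs)))"
    unfolding sum_tup_sum_list[OF sym\<mu>] by (simp add: algebra_simps del: of_nat_Suc)
  also have "\<dots> = a * ((\<Sum>xs\<in>?T. \<mu> xs * ln (\<mu> xs)) - real (Suc m) * (\<Sum>xs\<in>?T. \<mu> xs * ln (d (hd xs))))"
    unfolding a(2)[symmetric] by (simp add: algebra_simps del: of_nat_Suc)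
  also have "\<dots> = a * (\<Sum>xs\<in>?T. \<mu> xs * (ln (\<mu> xs) - sum_list (map (\<lambda>i. ln (d i)) xs)))"
    by (simp add: right_diff_distrib sum_subtractf sum_tup_sum_list[OF sym\<mu>] del: of_nat_Suc)
  also have "\<dots> \<ge> 0"
  proof (intro mult_nonneg_nonneg a(1))
    \<comment> \<open>\<open>\<mu>\<close> and the product of its marginals both have mass
      1.\<close>
    have "0 = (\<Sum>xs\<in>?T. \<mu> xs - mprod d xs)"
      using fin by (simp add: sum_subtractf \<mu>sum sum_tup_mprod dsum del: power_Suc)
    also have "\<dots> \<le> (\<Sum>xs\<in>?T. \<mu> xs * (ln (\<mu> xs) - sum_list (map (\<lambda>i. ln (d i)) xs)))"
    proof (rule sum_mono)
      fix xs assume xs: "xs \<in> ?T"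
      show "\<mu> xs - mprod d xs \<le> \<mu> xs * (ln (\<mu> xs) - sum_list (map (\<lambda>i. ln (d i)) xs))"
      proof (cases "\<mu> xs > 0")
        case True
        have "mprod d xs > 0" using dpos[OF xs True] by (rule mprod_pos)
        then show ?thesis
          using gibbs_term[OF True, of "mprod d xs"] ln_mprod[of xs d] dpos[OF xs True] by simp
      next
        case False
        then have "\<mu> xs = 0" using \<mu>0[of xs] by simp
        then show ?thesis using mprod_nonneg[of d xs] d0 by simp
      qed
    qed
    finally show "0 \<le> (\<Sum>xs\<in>?T. \<mu> xs * (ln (\<mu> xs) - sum_list (map (\<lambda>i. ln (d i)) xs)))" .
  qed
  finally have "1 \<le> (\<Sum>xs\<in>?T. \<mu> xs * (1 + L xs))"
    using \<mu>sum by (simp add: distrib_left sum.distrib)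
  also have "\<dots> \<le> (\<Sum>xs\<in>?T. \<mu> xs * W xs)" by (intro sum_mono W)
  finally have "Z powr (1 / s) \<le> Z powr (1 / s) * (\<Sum>xs\<in>?T. \<mu> xs * W xs)"
    using Z by simp
  also have "\<dots> = (\<Sum>k\<in>I. \<Sum>l\<in>tup m I. Z powr (1 / s) * (\<mu> (k # l) * W (k # l)))"
    using fin by (simp add: sum_tup_Suc sum_distrib_left)
  also have "\<dots> \<le> (\<Sum>k\<in>I. x k * sqrt (\<Sum>l\<in>tup m I. (v (k # l) * mprod x l)\<^sup>2))"
  proof (rule sum_mono)
    fix k
    have term_eq: "Z powr (1 / s) * (\<mu> (k # l) * W (k # l)) =
        x k * d k powr (- 1 / 2) * (\<bar>v (k # l) * mprod x l\<bar> * \<bar>sqrt (\<mu> (k # l))\<bar>)" for l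
    proof (cases "\<mu> (k # l) > 0")
      case True
      have "v (k # l) = (v (k # l) powr s) powr (1 / s)"
        using s(1) v0 by (simp add: powr_powr)
      also have "v (k # l) powr s = Z * \<mu> (k # l)" using Z by (simp add: \<mu>_def)
      also have "\<dots> powr (1 / s) = Z powr (1 / s) * \<mu> (k # l) powr (1 / s)"
        using Z True by (simp add: powr_mult)
      finally have "v (k # l) * sqrt (\<mu> (k # l)) = Z powr (1 / s) * (\<mu> (k # l) powr (1 / s) * \<mu> (k # l) powr (1 / 2))"
        using True by (simp add: powr_half_sqrt)
      also have "\<mu> (k # l) powr (1 / s) * \<mu> (k # l) powr (1 / 2) = \<mu> (k # l) powr 1 * \<mu> (k # l) powr a"
        unfolding powr_add[symmetric] a_def by (rule arg_cong[of _ _ "\<lambda>e. \<mu> (k # l) powr e"]) simp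
      finally have "v (k # l) * sqrt (\<mu> (k # l)) = Z powr (1 / s) * (\<mu> (k # l) * \<mu> (k # l) powr a)"
        using True by simp
      moreover have "mprod x l \<ge> 0" by (rule mprod_nonneg) (simp add: x_def)
      ultimately show ?thesis
        using v0[of "k # l"] True by (simp add: W_def abs_mult mult_ac)
    next
      case False
      then have "\<mu> (k # l) = 0" using \<mu>0[of "k # l"] by simp
      then show ?thesis by simp
    qed
    have "(\<Sum>l\<in>tup m I. Z powr (1 / s) * (\<mu> (k # l) * W (k # l))) =
        x k * d k powr (- 1 / 2) * (\<Sum>l\<in>tup m I. \<bar>v (k # l) * mprod x l\<bar> * \<bar>sqrt (\<mu> (k # l))\<bar>)"
      unfolding term_eq by (rule sum_distrib_left[symmetric])
    also have "\<dots> \<le> x k * d k powr (- 1 / 2) *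
        (L2_set (\<lambda>l. v (k # l) * mprod x l) (tup m I) * L2_set (\<lambda>l. sqrt (\<mu> (k # l))) (tup m I))"
      by (intro mult_left_mono L2_set_mult_ineq) (auto simp: x_def)
    \<comment> \<open>The second Cauchy-Schwarz factor is the root of the marginal; it cancels the
      weight \<open>d k powr (- 1 / 2)\<close> built into \<open>W\<close>.\<close>
    also have "L2_set (\<lambda>l. sqrt (\<mu> (k # l))) (tup m I) = sqrt (d k)"
      using \<mu>0 by (simp add: L2_set_def d_def)
    also have "x k * d k powr (- 1 / 2) * (L2_set (\<lambda>l. v (k # l) * mprod x l) (tup m I) * sqrt (d k))
       \<le> x k * L2_set (\<lambda>l. v (k # l) * mprod x l) (tup m I)"
    proof (cases "d k = 0")
      case False
      then have one: "d k powr (- 1 / 2) * sqrt (d k) = 1"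
        using d0[of k] by (simp add: powr_half_sqrt[symmetric] flip: powr_add)
      have eq: "x k * d k powr (- 1 / 2) * (L2_set (\<lambda>l. v (k # l) * mprod x l) (tup m I) * sqrt (d k))
          = x k * L2_set (\<lambda>l. v (k # l) * mprod x l) (tup m I) * (d k powr (- 1 / 2) * sqrt (d k))"
        by (simp only: mult_ac)
      show ?thesis unfolding eq one by simp
    qed (simp add: x_def)
    finally show "(\<Sum>l\<in>tup m I. Z powr (1 / s) * (\<mu> (k # l) * W (k # l)))
        \<le> x k * sqrt (\<Sum>l\<in>tup m I. (v (k # l) * mprod x l)\<^sup>2)"
      by (simp add: L2_set_def)
  qed
  finally show ?thesis
    using p0 d0 dsum by (intro exI[of _ x]) (simp add: x_def powr_powr Z_def)
qed

section \<open>Off-diagonal and diagonal estimates separately\<close>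

definition lp_bound :: "real \<Rightarrow> nat \<Rightarrow> 'a set \<Rightarrow> ('a list \<Rightarrow> complex) \<Rightarrow> real \<Rightarrow> bool" where
  "lp_bound p m I c M \<longleftrightarrow> (\<forall>z. (\<Sum>i\<in>I. norm (z i) powr p) \<le> 1 \<longrightarrow> norm (form_val m I c z) \<le> M)"

definition hl_exp :: "nat \<Rightarrow> real \<Rightarrow> real" where
  "hl_exp m p = 2 * real m * p / (real m * p + p - 2 * real m)"

lemma inverse_hl_exp:
  assumes "m \<ge> 1" "p > 0"
  shows "1 / hl_exp m p = 1 / 2 + 1 / (2 * real m) - 1 / p"
  using assms by (simp add: hl_exp_def field_simps)

text \<open>The lower bound \<open>2 * m / (m + 1)\<close> is the Bohnenblust-Hille exponent, the
  limit as \<open>p\<close> tends to infinity. It keeps the exponent within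
  \<open>2 / (m + 1)\<close> of 2.\<close>

lemma hl_exp_bounds:
  assumes "m \<ge> 1" "p \<ge> 2 * real m"
  shows "1 \<le> hl_exp m p" "hl_exp m p \<le> 2" "2 * real m / (real m + 1) \<le> hl_exp m p" "hl_exp m p > 0"
proof -
  have p: "p > 0" using assms by linarith
  have D: "real m * p + p - 2 * real m > 0" using assms p by (smt (verit) mult_pos_pos of_nat_1 of_nat_mono)
  show "hl_exp m p > 0" unfolding hl_exp_def using D p assms by (intro divide_pos_pos mult_pos_pos) auto
  have "p \<le> real m * p" using assms p by simp
  then have "real m * p + p - 2 * real m \<le> 2 * real m * p" using assms(1) by linarith
  then show "1 \<le> hl_exp m p" unfolding hl_exp_def using D by (simp only: le_divide_eq_1_pos)
  show "hl_exp m p \<le> 2" unfolding hl_exp_def using D assms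
    by (simp add: divide_le_eq algebra_simps)
  have "2 * real m * (real m * p + p - 2 * real m) \<le> 2 * real m * p * (real m + 1)"
    using assms by (simp add: algebra_simps)
  then show "2 * real m / (real m + 1) \<le> hl_exp m p"
    unfolding hl_exp_def using D by (simp add: divide_le_eq le_divide_eq)
qed

text \<open>Multiplying the polydisc coordinatewise by a point \<open>x\<close> of the
  \<open>\<ell>\<close>p ball keeps it inside that ball; the weights are absorbed into the
  coefficients.\<close>

lemma lp_bound_disc_bound:
  assumes "lp_bound p m I c M" "p > 0" "\<And>i. x i \<ge> 0" "(\<Sum>i\<in>I. x i powr p) \<le> 1"
  shows "disc_bound m I (\<lambda>xs. c xs * of_real (mprod x xs)) M"
  unfolding disc_bound_def
proof (intro allI impI)
  fix y :: "'a \<Rightarrow> complex" assume y: "\<forall>i\<in>I. norm (y i) \<le> 1"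
  have "of_real (mprod x xs) = (mprod (\<lambda>i. of_real (x i)) xs :: complex)" for xs
    by (induction xs) auto
  then have "form_val m I (\<lambda>xs. c xs * of_real (mprod x xs)) y = form_val m I c (\<lambda>i. of_real (x i) * y i)"
    by (simp add: form_val_def mprod_mult mult_ac)
  moreover have "(\<Sum>i\<in>I. norm (of_real (x i) * y i) powr p) \<le> (\<Sum>i\<in>I. x i powr p)"
    using assms y by (intro sum_mono powr_mono2) (auto simp: norm_mult intro: mult_left_le)
  ultimately show "norm (form_val m I (\<lambda>xs. c xs * of_real (mprod x xs)) y) \<le> M"
    using assms by (simp add: lp_bound_def)
qed

lemma symm_on_mult_mprod:
  "symm_on m I c \<Longrightarrow> symm_on m I (\<lambda>xs. c xs * of_real (mprod x xs))"
  unfolding symm_on_def using mprod_mset by metis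

text \<open>Replacing \<open>s\<close> by 2 costs at most a factor
  \<open>m powr (1 / (m + 1))\<close>, which is bounded by 2.\<close>

lemma powr_neg_half_le:
  assumes "m \<ge> 1" "2 * real m / (real m + 1) \<le> s"
  shows "real m powr (- s / 2) \<le> 2 / m"
proof -
  have "real m powr (- s / 2) \<le> real m powr (1 / (real m + 1) - 1)"
    using assms by (intro powr_mono) (auto simp: field_simps)
  also have "\<dots> = real m powr (1 / (real m + 1)) / m"
    using assms by (simp add: powr_diff)
  also have "real m powr (1 / (real m + 1)) \<le> (2 powr (real m + 1)) powr (1 / (real m + 1))"
  proof (intro powr_mono2)
    have "real m < 2 ^ m" by (rule of_nat_less_two_power)
    also have "(2::real) ^ m \<le> 2 ^ (m + 1)" by simp
    also have "\<dots> = 2 powr (real m + 1)" by (simp add: powr_realpow powr_add)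
    finally show "real m \<le> 2 powr (real m + 1)" by simp
  qed auto
  also have "\<dots> = 2" by (simp add: powr_powr)
  finally show ?thesis using assms by (simp add: divide_right_mono)
qed

text \<open>\<open>20 * moment_const\<close> comes from the polydisc bound, the square from
  \<open>s \<le> 2\<close>, and the factor 2 from \<open>powr_neg_half_le\<close>.\<close>

definition off_diag_const :: real where "off_diag_const = 2 * (20 * moment_const)\<^sup>2"

lemma off_diag_const_ge_1: "off_diag_const \<ge> 1"
proof -
  have "1 \<le> (20 * moment_const)\<^sup>2" using moment_const_ge_1 by (intro one_le_power) auto
  then show ?thesis by (simp add: off_diag_const_def)
qed

lemma lp_bound_nonneg:
  assumes "lp_bound p m I c M" "p > 0"
  shows "M \<ge> 0"
proof -
  have "norm (form_val m I c (\<lambda>_. 0)) \<le> M" using assms by (simp add: lp_bound_def)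
  then show ?thesis by (rule order_trans[OF norm_ge_zero])
qed

text \<open>The Blei-type inequality is applied to the moduli with the diagonal set to 0. Its
  weights pass into \<open>c'\<close>, which is bounded on the polydisc, where the estimate gains
  \<open>1 / sqrt m\<close>; raised to the power \<open>s\<close>, close to 2, this becomes of order
  \<open>1 / m\<close>.\<close>

lemma off_diag_le:
  fixes c :: "'a list \<Rightarrow> complex"
  assumes fin: "finite I" and sym: "symm_on m I c" and m: "m \<ge> 1" and p: "p \<ge> 2 * real m"
    and M: "lp_bound p m I c M"
  shows "(\<Sum>xs\<in>tup m I. if off_diag xs then norm (c xs) powr hl_exp m p else 0) \<le> off_diag_const / m * M powr hl_exp m p"
proof -
  define s where "s = hl_exp m p"
  define v where "v xs = (if off_diag xs then norm (c xs) else 0)" for xs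
  define Z where "Z = (\<Sum>xs\<in>tup m I. v xs powr s)"
  have p0: "p > 0" using p m by simp
  note s = hl_exp_bounds[OF m p, folded s_def] inverse_hl_exp[OF m p0, folded s_def]
  have M0: "M \<ge> 0" using M p0 by (rule lp_bound_nonneg)
  obtain m' where m': "m = Suc m'" using m by (cases m) auto
  have "Z \<le> off_diag_const / m * M powr s"
  proof (cases "Z > 0")
    case False
    moreover have "0 \<le> off_diag_const / m * M powr s" using off_diag_const_ge_1 by simp
    ultimately show ?thesis by linarith
  next
    case True
    have symv: "symm_on (Suc m') I v"
      unfolding symm_on_def
    proof (intro ballI allI impI)
      fix xs ys assume xs: "xs \<in> tup (Suc m') I" "mset xs = mset ys"
      then have "set xs = set ys" by (metis set_mset_mset)
      moreover have "c xs = c ys"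
        by (rule symm_onD[OF sym]) (use xs m' in auto)
      ultimately show "v xs = v ys" by (simp add: v_def off_diag_def)
    qed
    have v0: "v xs \<ge> 0" for xs by (simp add: v_def)
    have Z': "(\<Sum>xs\<in>tup (Suc m') I. v xs powr s) > 0" using True unfolding Z_def m' .
    obtain x where x: "\<And>i. x i \<ge> 0" "(\<Sum>i\<in>I. x i powr p) \<le> 1"
      and le: "(\<Sum>xs\<in>tup (Suc m') I. v xs powr s) powr (1 / s)
          \<le> (\<Sum>k\<in>I. x k * sqrt (\<Sum>l\<in>tup m' I. (v (k # l) * mprod x l)\<^sup>2))"
      using blei_marginal[OF fin symv v0 p[unfolded m'] s(4) s(5)[unfolded m'] Z'] by blast
    define c' where "c' xs = c xs * of_real (mprod x xs)" for xs
    have "x k * sqrt (\<Sum>l\<in>tup m' I. (v (k # l) * mprod x l)\<^sup>2) =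
        sqrt (\<Sum>l\<in>tup m' I. if off_diag (k # l) then (norm (c' (k # l)))\<^sup>2 else 0)" for k
    proof -
      have "x k * sqrt (\<Sum>l\<in>tup m' I. (v (k # l) * mprod x l)\<^sup>2) = sqrt ((x k)\<^sup>2 * (\<Sum>l\<in>tup m' I. (v (k # l) * mprod x l)\<^sup>2))"
        using x(1)[of k] by (simp add: real_sqrt_mult)
      also have "(x k)\<^sup>2 * (\<Sum>l\<in>tup m' I. (v (k # l) * mprod x l)\<^sup>2) =
          (\<Sum>l\<in>tup m' I. if off_diag (k # l) then (norm (c' (k # l)))\<^sup>2 else 0)"
        unfolding sum_distrib_left
        by (intro sum.cong) (auto simp: v_def c'_def norm_mult power_mult_distrib)
      finally show ?thesis .
    qed
    with le have "Z powr (1 / s) \<le> (\<Sum>k\<in>I. sqrt (\<Sum>l\<in>tup m' I. if off_diag (k # l) then (norm (c' (k # l)))\<^sup>2 else 0))"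
      unfolding Z_def m' by (simp only:)
    also have "\<dots> \<le> 20 * moment_const * M / sqrt (Suc m')"
      unfolding c'_def
      by (rule sum_sqrt_off_diag_le[OF fin symm_on_mult_mprod[OF sym[unfolded m']] lp_bound_disc_bound[OF M[unfolded m'] p0 x]])
    finally have "(Z powr (1 / s)) powr s \<le> (20 * moment_const * M / sqrt m) powr s"
      unfolding m' using s(4) by (intro powr_mono2) auto
    then have "Z \<le> (20 * moment_const * M / sqrt m) powr s"
      using s(4) True by (simp add: powr_powr)
    also have "\<dots> = (20 * moment_const) powr s * M powr s * real m powr (- s / 2)"
    proof -
      have "sqrt m powr s = (real m powr (1 / 2)) powr s" by (simp only: powr_half_sqrt of_nat_0_le_iff)
      also have "\<dots> = real m powr (- (- s / 2))" by (simp add: powr_powr)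
      finally have si: "sqrt m powr s = inverse (real m powr (- s / 2))" by (simp only: powr_minus)
      have eq: "(20 * moment_const * M / sqrt m) powr s = (20 * moment_const) powr s * M powr s / sqrt m powr s"
        using M0 moment_const_ge_1 by (simp add: powr_divide powr_mult)
      show ?thesis unfolding eq si by (simp only: divide_inverse inverse_inverse_eq)
    qed
    also have "\<dots> \<le> (20 * moment_const)\<^sup>2 * M powr s * (2 / m)"
    proof (intro mult_mono powr_neg_half_le m s(3))
      have "(20 * moment_const) powr s \<le> (20 * moment_const) powr 2" using s(2) moment_const_ge_1 by (intro powr_mono) auto
      then show "(20 * moment_const) powr s \<le> (20 * moment_const)\<^sup>2" using moment_const_ge_1 by simp
    qed auto
    finally show ?thesis by (simp add: off_diag_const_def)
  qed
  moreover have "(\<Sum>xs\<in>tup m I. if off_diag xs then norm (c xs) powr s else 0) = Z"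
    unfolding Z_def v_def by (intro sum.cong) auto
  ultimately show ?thesis unfolding s_def by simp
qed

text \<open>The case \<open>t = m\<close> at the origin: all variables vanish, and the remaining
  form of degree 0 is the diagonal coefficient itself.\<close>

lemma sum_diag_mult_le:
  fixes c :: "'a list \<Rightarrow> complex"
  assumes fin: "finite I" and sym: "symm_on m I c" and m: "m \<ge> 1" and p: "p > 0"
    and M: "lp_bound p m I c M" and x: "\<And>i. x i \<ge> 0" "(\<Sum>i\<in>I. x i powr p) \<le> 1"
  shows "(\<Sum>k\<in>I. norm (c (replicate m k)) * x k ^ m) \<le> M"
  using sum_norm_coeff_le[OF fin symm_on_mult_mprod[OF sym, of x] lp_bound_disc_bound[OF M p x], of m "\<lambda>_. 0"] m x
  by (simp add: form_val_def norm_mult norm_power)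

text \<open>The converse of Hoelder's inequality: \<open>q\<close> is conjugate to
  \<open>p / m\<close>, since \<open>1 / q + m / p = 1\<close>.\<close>

lemma diag_le:
  fixes c :: "'a list \<Rightarrow> complex"
  assumes fin: "finite I" and sym: "symm_on m I c" and m: "m \<ge> 1" and p: "p \<ge> 2 * real m"
    and M: "lp_bound p m I c M"
  shows "(\<Sum>k\<in>I. norm (c (replicate m k)) powr (p / (p - m))) \<le> M powr (p / (p - m))"
proof -
  define q where "q = p / (p - m)"
  define S where "S = (\<Sum>k\<in>I. norm (c (replicate m k)) powr q)"
  have p0: "p > 0" and pm: "p - m > 0" using p m by auto
  have q: "q > 0" "1 + q * (m / p) = q" "(1 - m / p) * q = 1"
    using p0 pm by (simp_all add: q_def field_simps)
  have "S \<le> M powr q"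
  proof (cases "S > 0")
    case False
    moreover have "0 \<le> M powr q" by simp
    ultimately show ?thesis by linarith
  next
    case True
    \<comment> \<open>The extremal vector for Hoelder's inequality, normalised in
      \<open>\<ell>\<close>p.\<close>
    define x where "x k = (norm (c (replicate m k)) powr q / S) powr (1 / p)" for k
    have "(\<Sum>k\<in>I. x k powr p) = (\<Sum>k\<in>I. norm (c (replicate m k)) powr q / S)"
      using True p0 by (simp add: x_def powr_powr)
    also have "\<dots> = 1" using True by (simp add: S_def flip: sum_divide_distrib)
    finally have xs: "(\<Sum>k\<in>I. x k powr p) \<le> 1" by simp
    have "x i \<ge> 0" for i by (simp add: x_def)
    then have "(\<Sum>k\<in>I. norm (c (replicate m k)) * x k ^ m) \<le> M"
      using xs by (rule sum_diag_mult_le[OF fin sym m p0 M])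
    moreover have "norm (c (replicate m k)) * x k ^ m = norm (c (replicate m k)) powr q / S powr (m / p)" for k
    proof (cases "c (replicate m k) = 0")
      case True then show ?thesis using m by (simp add: x_def)
    next
      case False
      let ?n = "norm (c (replicate m k))"
      have "x k > 0" using False True by (simp add: x_def)
      then have "x k ^ m = x k powr m" by (simp add: powr_realpow)
      also have "\<dots> = ?n powr (q * (m / p)) / S powr (m / p)"
        using False True by (simp add: x_def powr_powr powr_divide)
      also have "?n * \<dots> = ?n powr (1 + q * (m / p)) / S powr (m / p)"
        using False by (simp add: powr_add)
      finally show ?thesis unfolding q(2) .
    qed
    ultimately have "(\<Sum>k\<in>I. norm (c (replicate m k)) powr q / S powr (m / p)) \<le> M" by (simp only:)
    then have "S / S powr (m / p) \<le> M" by (simp only: S_def sum_divide_distrib)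
    then have "S powr (1 - m / p) \<le> M" using True by (simp add: powr_diff)
    then have "(S powr (1 - m / p)) powr q \<le> M powr q" using q(1) by (intro powr_mono2) auto
    moreover have "(S powr (1 - m / p)) powr q = S"
      unfolding powr_powr q(3) using True by simp
    ultimately show ?thesis by (simp only:)
  qed
  then show ?thesis by (simp only: S_def q_def)
qed

section \<open>Stability near an extremal diagonal form\<close>

text \<open>Tested against the nonnegative kernel \<open>1 + Re (\<beta> \<omega>\<^sup>-\<^sup>t)\<close>.\<close>

lemma norm_coeff_add_half_le:
  fixes b :: "nat \<Rightarrow> complex"
  assumes t: "1 \<le> t" "t \<le> d"
    and le: "\<And>w. norm w = 1 \<Longrightarrow> norm (\<Sum>k\<le>d. b k * w ^ k) \<le> 1"
  shows "norm (b 0) + norm (b t) / 2 \<le> 1"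
proof -
  define N where "N = Suc (2 * d)"
  have N: "2 * d < N" "N > 0" by (auto simp: N_def)
  define f where "f = (\<lambda>w. \<Sum>k\<le>d. b k * w ^ k)"
  define u where "u x = (if x = 0 then 1 else sgn x)" for x :: complex
  have u: "norm (u x) = 1" "x = norm x * u x" for x
    by (auto simp: u_def sgn_eq norm_divide)
  have uu: "cnj (u x) * u x = 1" for x
    using complex_norm_square[of "u x"] u(1)[of x] by (simp add: mult.commute)
  define \<beta> where "\<beta> = u (b 0) * cnj (u (b t))"
  define \<kappa> where "\<kappa> r = 1 + (\<beta> * unity_root N r ^ (N - t) + cnj \<beta> * unity_root N r ^ t) / 2" for r
  define \<rho> where "\<rho> r = 1 + Re (cnj \<beta> * unity_root N r ^ t)" for r
  have \<kappa>: "\<kappa> r = of_real (\<rho> r)" for r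
  proof -
    define z where "z = cnj \<beta> * unity_root N r ^ t"
    have "\<beta> * unity_root N r ^ (N - t) = cnj z"
      using t N by (simp add: unity_root_power_cnj z_def)
    then have "\<kappa> r = 1 + (cnj z + z) / 2" by (simp add: \<kappa>_def z_def)
    then show ?thesis by (simp add: \<rho>_def z_def[symmetric] complex_eq_iff)
  qed
  have \<beta>1: "norm \<beta> = 1" by (simp add: \<beta>_def norm_mult u)
  have \<rho>0: "\<rho> r \<ge> 0" for r
  proof -
    have "\<bar>Re (cnj \<beta> * unity_root N r ^ t)\<bar> \<le> 1"
      using abs_Re_le_cmod[of "cnj \<beta> * unity_root N r ^ t"] \<beta>1 by (simp add: norm_mult norm_power)
    then show ?thesis by (simp add: \<rho>_def)
  qed
  have coeffs: "(\<Sum>r<N. f (unity_root N r)) = of_nat N * b 0"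
    "(\<Sum>r<N. f (unity_root N r) * unity_root N r ^ (N - t)) = of_nat N * b t"
    "(\<Sum>r<N. f (unity_root N r) * unity_root N r ^ t) = 0"
    unfolding f_def by (rule unity_root_coeffs[OF t N(1)])+
  have "(\<Sum>r<N. \<rho> r) = N"
  proof -
    have "\<not> N dvd t" "\<not> N dvd N - t" using t N by (auto dest: dvd_imp_le)
    then have "(\<Sum>r<N. \<kappa> r) = of_nat N"
      using N by (simp add: \<kappa>_def sum.distrib add_divide_distrib sum_divide_distrib[symmetric]
          sum_distrib_left[symmetric] sum_unity_root_power)
    then have "complex_of_real (\<Sum>r<N. \<rho> r) = of_real (real N)" by (simp add: \<kappa>)
    then show ?thesis by (simp only: of_real_eq_iff)
  qed
  have "(\<Sum>r<N. f (unity_root N r) * \<kappa> r) =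
     (\<Sum>r<N. f (unity_root N r)) + (\<beta> * (\<Sum>r<N. f (unity_root N r) * unity_root N r ^ (N - t))
       + cnj \<beta> * (\<Sum>r<N. f (unity_root N r) * unity_root N r ^ t)) / 2"
    unfolding \<kappa>_def sum_distrib_left sum.distrib[symmetric] sum_divide_distrib
    by (intro sum.cong) (auto simp: algebra_simps add_divide_distrib)
  also have "\<dots> = of_nat N * (b 0 + \<beta> * b t / 2)" unfolding coeffs by (simp add: algebra_simps)
  also have "\<beta> * b t = u (b 0) * (norm (b t) * (cnj (u (b t)) * u (b t)))"
    unfolding \<beta>_def by (subst (2) u(2)) (simp add: mult_ac)
  also have "\<dots> = u (b 0) * norm (b t)" by (simp add: uu)
  also have "b 0 + \<dots> / 2 = u (b 0) * (norm (b 0) + norm (b t) / 2)"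
    by (subst u(2)[of "b 0"]) (simp add: algebra_simps)
  finally have "(\<Sum>r<N. f (unity_root N r) * \<kappa> r) = of_nat N * (u (b 0) * of_real (norm (b 0) + norm (b t) / 2))"
    by simp
  then have "norm (\<Sum>r<N. f (unity_root N r) * \<kappa> r) = N * (norm (b 0) + norm (b t) / 2)"
    by (simp only: norm_mult norm_of_nat u(1) norm_of_real) simp
  moreover have "norm (\<Sum>r<N. f (unity_root N r) * \<kappa> r) \<le> (\<Sum>r<N. \<rho> r)"
  proof (intro order_trans[OF norm_sum] sum_mono)
    fix r
    have "norm (f (unity_root N r)) \<le> 1" unfolding f_def by (rule le) simp
    then show "norm (f (unity_root N r) * \<kappa> r) \<le> \<rho> r"
      using \<rho>0[of r] by (simp add: \<kappa> norm_mult mult_left_le_one_le)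
  qed
  ultimately show ?thesis using N \<open>(\<Sum>r<N. \<rho> r) = N\<close> by simp
qed

section \<open>Joining the diagonal and off-diagonal parts\<close>

lemma sum_off_diag_split:
  fixes f :: "'a list \<Rightarrow> real"
  assumes "finite I" "m \<ge> 1"
  shows "(\<Sum>xs\<in>tup m I. f xs) = (\<Sum>xs\<in>tup m I. if off_diag xs then f xs else 0) + (\<Sum>k\<in>I. f (replicate m k))"
proof -
  have "{xs \<in> tup m I. \<not> off_diag xs} = replicate m ` I"
  proof safe
    fix xs assume xs: "xs \<in> tup m I" "\<not> off_diag xs"
    then obtain k where "set xs \<subseteq> {k}" by (auto simp: off_diag_def)
    moreover have "length xs = m" "set xs \<subseteq> I" using xs by (auto simp: tup_def)
    ultimately have "xs = replicate m k" "k \<in> I"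
      using assms(2) by (auto simp: subset_singleton_iff intro!: replicate_eqI)
    then show "xs \<in> replicate m ` I" by auto
  qed (auto simp: tup_def off_diag_def)
  moreover have "inj_on (replicate m) I" using assms(2) by (auto simp: inj_on_def)
  ultimately have "(\<Sum>xs | xs \<in> tup m I \<and> \<not> off_diag xs. f xs) = (\<Sum>k\<in>I. f (replicate m k))"
    by (simp add: sum.reindex)
  moreover have "(\<Sum>xs\<in>tup m I. f xs) = (\<Sum>xs | xs \<in> tup m I \<and> off_diag xs. f xs) + (\<Sum>xs | xs \<in> tup m I \<and> \<not> off_diag xs. f xs)"
    using assms(1) by (subst sum.union_disjoint[symmetric]) (auto intro!: sum.cong)
  moreover have "(\<Sum>xs | xs \<in> tup m I \<and> off_diag xs. f xs) = (\<Sum>xs\<in>tup m I. if off_diag xs then f xs else 0)"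
    using assms(1) by (simp add: sum.inter_filter)
  ultimately show ?thesis by simp
qed

lemma norm_diag_le:
  fixes c :: "'a list \<Rightarrow> complex"
  assumes fin: "finite I" and sym: "symm_on m I c" and m: "m \<ge> 1" and p: "p \<ge> 2 * real m"
    and M: "lp_bound p m I c M" and k: "k \<in> I"
  shows "norm (c (replicate m k)) \<le> M"
proof -
  have p0: "p > 0" using p m by simp
  have "norm (c (replicate m k)) = (\<Sum>i\<in>I. if i = k then norm (c (replicate m i)) else 0)"
    using fin k by simp
  also have "\<dots> = (\<Sum>i\<in>I. norm (c (replicate m i)) * (if i = k then 1 else 0) ^ m)"
    using m by (intro sum.cong) auto
  also have "\<dots> \<le> M"
  proof (rule sum_diag_mult_le[OF fin sym m p0 M])
    have "(\<Sum>i\<in>I. (if i = k then 1 else 0) powr p) = (\<Sum>i\<in>I. if i = k then 1 else (0::real))"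
      using p0 by (intro sum.cong) auto
    then show "(\<Sum>i\<in>I. (if i = k then 1 else 0) powr p) \<le> (1::real)" using fin k by simp
  qed auto
  finally show ?thesis .
qed

text \<open>The factored form shows that the gap between the two exponents is nonnegative, and that
  it closes at \<open>p = 2m\<close>.\<close>

lemma hl_exp_minus:
  assumes "m \<ge> 1" "p \<ge> 2 * real m"
  shows "hl_exp m p - p / (p - m) =
    (p * (real m - 1) / (real m * p + p - 2 * real m)) * ((p - 2 * real m) / (p - m))"
proof -
  have "p > 0" "p - m > 0" using assms by auto
  moreover have "real m * p + p - 2 * real m > 0"
  proof -
    have "p \<le> real m * p" using assms \<open>p > 0\<close> by simp
    then show ?thesis using assms \<open>p > 0\<close> by linarith
  qed
  ultimately show ?thesis
    unfolding hl_exp_def by (simp add: divide_simps) (simp add: algebra_simps power2_eq_square)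
qed

lemma hl_exp_ge:
  assumes "m \<ge> 1" "p \<ge> 2 * real m"
  shows "p / (p - m) \<le> hl_exp m p" "1 \<le> p / (p - m)"
proof -
  have p: "p > 0" "p - m > 0" using assms by auto
  have "p \<le> real m * p" using assms p by simp
  then have D: "real m * p + p - 2 * real m > 0" using assms p by linarith
  have "0 \<le> hl_exp m p - p / (p - m)"
    unfolding hl_exp_minus[OF assms] using assms D p by (intro mult_nonneg_nonneg divide_nonneg_pos) auto
  then show "p / (p - m) \<le> hl_exp m p" by simp
  show "1 \<le> p / (p - m)" using p by simp
qed

text \<open>The diagonal is already controlled in the smaller exponent; the excess power is
  estimated by the largest diagonal modulus. For a bound 1 on the form, this is where a maximum
  below 1 leaves room.\<close>

lemma diag_powr_le:
  fixes c :: "'a list \<Rightarrow> complex"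
  assumes fin: "finite I" and sym: "symm_on m I c" and m: "m \<ge> 1" and p: "p \<ge> 2 * real m"
    and M: "lp_bound p m I c M" and \<kappa>: "\<And>k. k \<in> I \<Longrightarrow> norm (c (replicate m k)) \<le> \<kappa>"
  shows "(\<Sum>k\<in>I. norm (c (replicate m k)) powr hl_exp m p)
    \<le> M powr (p / (p - m)) * \<kappa> powr (hl_exp m p - p / (p - m))"
proof -
  let ?q = "p / (p - m)" and ?s = "hl_exp m p"
  have "(\<Sum>k\<in>I. norm (c (replicate m k)) powr ?s) \<le> (\<Sum>k\<in>I. norm (c (replicate m k)) powr ?q * \<kappa> powr (?s - ?q))"
  proof (rule sum_mono)
    fix k assume k: "k \<in> I"
    have "norm (c (replicate m k)) powr ?s = norm (c (replicate m k)) powr ?q * norm (c (replicate m k)) powr (?s - ?q)"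
      by (simp flip: powr_add)
    also have "\<dots> \<le> norm (c (replicate m k)) powr ?q * \<kappa> powr (?s - ?q)"
      using hl_exp_ge[OF m p] \<kappa>[OF k] by (intro mult_left_mono powr_mono2) auto
    finally show "norm (c (replicate m k)) powr ?s \<le> norm (c (replicate m k)) powr ?q * \<kappa> powr (?s - ?q)" .
  qed
  also have "\<dots> = (\<Sum>k\<in>I. norm (c (replicate m k)) powr ?q) * \<kappa> powr (?s - ?q)"
    by (rule sum_distrib_right[symmetric])
  also have "\<dots> \<le> M powr ?q * \<kappa> powr (?s - ?q)"
    by (intro mult_right_mono diag_le[OF fin sym m p M]) auto
  finally show ?thesis .
qed

lemma sum_powr_le:
  fixes c :: "'a list \<Rightarrow> complex"
  assumes fin: "finite I" and sym: "symm_on m I c" and m: "m \<ge> 1" and p: "p \<ge> 2 * real m"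
    and M: "lp_bound p m I c M"
  shows "(\<Sum>xs\<in>tup m I. norm (c xs) powr hl_exp m p) \<le> (1 + off_diag_const / m) * M powr hl_exp m p"
proof -
  have M0: "M \<ge> 0" using M p m by (intro lp_bound_nonneg[OF M]) auto
  have "(\<Sum>k\<in>I. norm (c (replicate m k)) powr hl_exp m p) \<le> M powr (p / (p - m)) * M powr (hl_exp m p - p / (p - m))"
    by (rule diag_powr_le[OF fin sym m p M norm_diag_le[OF fin sym m p M]])
  also have "\<dots> = M powr hl_exp m p" by (simp flip: powr_add)
  finally show ?thesis
    using off_diag_le[OF fin sym m p M]
    by (subst sum_off_diag_split[OF fin m]) (simp only: distrib_right mult_1_left)
qed

section \<open>Coefficient forms around a large diagonal entry\<close>

lemma form_val_scale:
  "form_val d J e (\<lambda>i. a * w i) = a ^ d * form_val d J e w"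
proof -
  have "mprod (\<lambda>i. a * w i) l = a ^ length l * mprod w l" for l
    by (induction l) (auto simp: mult_ac)
  then show ?thesis
    unfolding form_val_def sum_distrib_left by (intro sum.cong) (auto simp: tup_def mult_ac)
qed

lemma form_val_cmult: "form_val d J (\<lambda>l. a * e l) w = a * form_val d J e w"
  by (simp add: form_val_def sum_distrib_left mult_ac)

lemma form_val_cong: "(\<And>i. i \<in> I \<Longrightarrow> z i = w i) \<Longrightarrow> form_val m I c z = form_val m I c w"
  unfolding form_val_def
  by (intro sum.cong refl arg_cong2[of _ _ _ _ "(*)"] mprod_cong) (auto simp: tup_def)

text \<open>Variable \<open>j\<close> gets mass \<open>1 - \<delta>\<close>, the others mass
  \<open>\<delta>\<close> and a common rotation \<open>\<zeta>\<close>. As a polynomial in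
  \<open>\<zeta>\<close> the form has a constant term of modulus at least
  \<open>1 - 2 * \<delta>\<close>, so the coefficient of \<open>\<zeta> ^ k\<close> is at most
  \<open>4 * \<delta>\<close>; undoing the scaling \<open>B ^ k\<close> yields the power of
  \<open>\<delta>\<close>.\<close>

lemma lp_bound_coeff:
  fixes c :: "'a list \<Rightarrow> complex"
  assumes fin: "finite J" and j: "j \<notin> J" and sym: "symm_on m (insert j J) c"
    and k: "1 \<le> k" "k \<le> m" and p: "p \<ge> 2 * real m"
    and M: "lp_bound p m (insert j J) c 1"
    and \<delta>: "0 < \<delta>" "\<delta> \<le> 1 / 2" "1 - \<delta> \<le> norm (c (replicate m j))"
  shows "lp_bound p k J (\<lambda>l. of_nat (m choose k) * c (replicate (m - k) j @ l)) (8 * \<delta> powr (1 - k / p))"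
  unfolding lp_bound_def
proof (intro allI impI)
  fix w :: "'a \<Rightarrow> complex" assume w: "(\<Sum>i\<in>J. norm (w i) powr p) \<le> 1"
  have p0: "p > 0" using p k by auto
  define A where "A = (1 - \<delta>) powr (1 / p)"
  define B where "B = \<delta> powr (1 / p)"
  define P where "P t = form_val t J (\<lambda>l. of_nat (m choose t) * c (replicate (m - t) j @ l)) w" for t
  define b where "b t = of_real (B ^ t * A ^ (m - t)) * P t" for t
  have AB: "A > 0" "B > 0" "A powr p = 1 - \<delta>" "B powr p = \<delta>"
    using \<delta> p0 by (auto simp: A_def B_def powr_powr)
  have "norm (\<Sum>t\<le>m. b t * \<zeta> ^ t) \<le> 1" if \<zeta>: "norm \<zeta> = 1" for \<zeta>
  proof -
    define z where "z = (\<lambda>i. (of_real B * \<zeta>) * w i)"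
    define y where "y = z(j := of_real A)"
    have "(\<Sum>i\<in>insert j J. norm (y i) powr p) = norm (y j) powr p + (\<Sum>i\<in>J. norm (y i) powr p)"
      using fin j by simp
    also have "(\<Sum>i\<in>J. norm (y i) powr p) = (\<Sum>i\<in>J. \<delta> * norm (w i) powr p)"
    proof (intro sum.cong refl)
      fix i assume "i \<in> J"
      then have "norm (y i) = B * norm (w i)" using j AB \<zeta> by (auto simp: y_def z_def norm_mult)
      then show "norm (y i) powr p = \<delta> * norm (w i) powr p" using AB by (simp add: powr_mult)
    qed
    also have "\<dots> \<le> \<delta>" unfolding sum_distrib_left[symmetric] using w \<delta> by (simp add: mult_left_le)
    also have "norm (y j) powr p = 1 - \<delta>" using AB by (simp add: y_def)
    finally have "(\<Sum>i\<in>insert j J. norm (y i) powr p) \<le> 1" by simp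
    then have "norm (form_val m (insert j J) c y) \<le> 1" using M by (simp add: lp_bound_def)
    also have "form_val m (insert j J) c y =
        (\<Sum>t\<le>m. of_nat (m choose t) * form_val (m - t) J (\<lambda>l. c (replicate t j @ l)) z * of_real A ^ t)"
      unfolding y_def by (rule form_val_split[OF fin j sym])
    also have "\<dots> = (\<Sum>t\<le>m. b t * \<zeta> ^ t)"
    \<comment> \<open>The expansion counts the copies of \<open>j\<close>, whereas \<open>b\<close>
      is indexed by the number of other entries.\<close>
    proof (rule sum.reindex_bij_witness[of _ "\<lambda>t. m - t" "\<lambda>t. m - t"])
      fix t assume "t \<in> {..m}"
      then show "b (m - t) * \<zeta> ^ (m - t) =
          of_nat (m choose t) * form_val (m - t) J (\<lambda>l. c (replicate t j @ l)) z * of_real A ^ t"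
        using binomial_symmetric[of t m]
        by (simp add: b_def P_def z_def form_val_scale form_val_cmult power_mult_distrib mult_ac)
    qed auto
    finally show ?thesis .
  qed
  then have "norm (b 0) + norm (b k) / 2 \<le> 1"
    using k by (intro norm_coeff_add_half_le[of k m b]) auto
  moreover have "1 - 2 * \<delta> \<le> norm (b 0)"
  proof -
    have "A ^ m = (1 - \<delta>) powr (m / p)"
      using AB \<delta> by (simp add: powr_realpow[symmetric] A_def powr_powr)
    also have "\<dots> \<ge> (1 - \<delta>) powr 1"
      using \<delta> p p0 by (intro powr_mono') auto
    finally have "1 - \<delta> \<le> A ^ m" using \<delta> by simp
    then have "(1 - \<delta>) * (1 - \<delta>) \<le> A ^ m * norm (c (replicate m j))"
      using \<delta> by (intro mult_mono) auto
    also have "\<dots> = norm (b 0)" using AB by (simp add: b_def P_def form_val_def norm_mult norm_power)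
    finally show ?thesis by (simp add: algebra_simps) (smt (verit) \<delta> zero_le_mult_iff)
  qed
  ultimately have bk: "norm (b k) \<le> 4 * \<delta>" by simp
  have "1 / 2 \<le> A ^ (m - k)"
  proof -
    have "1 / 2 \<le> (1 - \<delta>) powr 1" using \<delta> by simp
    also have "\<dots> \<le> (1 - \<delta>) powr (real (m - k) / p)"
      using \<delta> p p0 k by (intro powr_mono') (auto simp: of_nat_diff)
    also have "\<dots> = A ^ (m - k)"
      using AB \<delta> by (simp add: powr_realpow[symmetric] A_def powr_powr)
    finally show ?thesis .
  qed
  then have "B ^ k * (1 / 2) * norm (P k) \<le> B ^ k * A ^ (m - k) * norm (P k)"
    using AB by (intro mult_right_mono mult_left_mono) auto
  also have "\<dots> = norm (b k)" using AB by (simp add: b_def norm_mult norm_power)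
  also note bk
  finally have "norm (P k) \<le> 8 * (\<delta> / B ^ k)" using AB by (simp add: field_simps)
  also have "B ^ k = \<delta> powr (k / p)"
    using AB \<delta> by (simp add: powr_realpow[symmetric] B_def powr_powr)
  also have "\<delta> / \<dots> = \<delta> powr (1 - k / p)" using \<delta> by (simp add: powr_diff)
  finally show "norm (form_val k J (\<lambda>l. of_nat (m choose k) * c (replicate (m - k) j @ l)) w) \<le> 8 * \<delta> powr (1 - k / p)"
    by (simp add: P_def)
qed

lemma lp_bound_mono: "lp_bound p m I c M \<Longrightarrow> M \<le> M' \<Longrightarrow> lp_bound p m I c M'"
  unfolding lp_bound_def by (meson order_trans)

lemma symm_on_cmult: "symm_on m I c \<Longrightarrow> symm_on m I (\<lambda>xs. a * c xs :: complex)"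
  unfolding symm_on_def by metis

lemma hl_exp_mono:
  assumes "1 \<le> k" "k \<le> m" "p \<ge> 2 * real m"
  shows "hl_exp k p \<le> hl_exp m p"
proof -
  have p: "p > 0" "p \<ge> 2 * real k" using assms by auto
  have "1 / (2 * real m) \<le> 1 / (2 * real k)" using assms by (intro divide_left_mono) auto
  then have "1 / hl_exp m p \<le> 1 / hl_exp k p"
    using assms p by (simp add: inverse_hl_exp)
  moreover have "hl_exp m p > 0" "hl_exp k p > 0"
    using assms p by (auto intro!: hl_exp_bounds(4))
  ultimately show ?thesis by (simp add: field_simps)
qed

text \<open>A coefficient form of degree \<open>k\<close> is bounded in its own exponent
  \<open>r\<close>, but is needed in the larger exponent \<open>s\<close> of degree
  \<open>m\<close>. Each entry is at most \<open>K * M\<close>, so the excess power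
  \<open>s - r \<le> 1\<close> costs at most one more factor \<open>K\<close>.\<close>

lemma sum_powr_exp_mono:
  fixes e :: "'a \<Rightarrow> complex" and K :: real
  assumes "finite X" and le: "(\<Sum>l\<in>X. norm (e l) powr r) \<le> K * M powr r"
    and r: "1 \<le> r" "r \<le> s" "s \<le> 2" and K: "1 \<le> K" and M: "0 < M"
  shows "(\<Sum>l\<in>X. norm (e l) powr s) \<le> K\<^sup>2 * M powr s"
proof -
  have KM: "K * M powr r \<le> (K * M) powr r"
  proof -
    have "K powr 1 \<le> K powr r" using r K by (intro powr_mono) auto
    then show ?thesis using K M by (simp add: powr_mult mult_right_mono)
  qed
  have e: "norm (e l) \<le> K * M" if "l \<in> X" for l
  proof -
    have "norm (e l) powr r \<le> (\<Sum>l\<in>X. norm (e l) powr r)"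
      using assms that by (intro member_le_sum) auto
    also note le
    also note KM
    finally have h: "norm (e l) powr r \<le> (K * M) powr r" .
    have "(norm (e l) powr r) powr (1 / r) \<le> ((K * M) powr r) powr (1 / r)"
      by (rule powr_mono2[OF _ _ h]) (use r in auto)
    then show ?thesis using r K M by (simp add: powr_powr)
  qed
  have "(\<Sum>l\<in>X. norm (e l) powr s) \<le> (\<Sum>l\<in>X. norm (e l) powr r * (K * M) powr (s - r))"
  proof (rule sum_mono)
    fix l assume l: "l \<in> X"
    have "norm (e l) powr s = norm (e l) powr r * norm (e l) powr (s - r)"
      by (simp flip: powr_add)
    also have "\<dots> \<le> norm (e l) powr r * (K * M) powr (s - r)"
      using e[OF l] r by (intro mult_left_mono powr_mono2) auto
    finally show "norm (e l) powr s \<le> norm (e l) powr r * (K * M) powr (s - r)" .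
  qed
  also have "\<dots> = (\<Sum>l\<in>X. norm (e l) powr r) * (K * M) powr (s - r)"
    by (rule sum_distrib_right[symmetric])
  also have "\<dots> \<le> K * M powr r * (K * M) powr (s - r)"
    using le by (intro mult_right_mono) auto
  also have "\<dots> = K powr (1 + (s - r)) * M powr (r + (s - r))"
    using K M unfolding powr_add by (simp add: powr_mult)
  also have "K powr (1 + (s - r)) * M powr (r + (s - r)) \<le> K powr 2 * M powr s"
  proof (rule mult_mono)
    show "K powr (1 + (s - r)) \<le> K powr 2" using r K by (intro powr_mono) auto
  qed auto
  also have "K powr 2 = K\<^sup>2" using K by simp
  finally show ?thesis .
qed

text \<open>With \<open>s\<close> replaced by 2 the claim would hold with constant 1; the error is
  at most \<open>2 / (m + 1)\<close> in the exponent, and a base of at most \<open>2 ^ m\<close>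
  turns it into a factor of at most 4.\<close>

lemma choose_powr_le:
  assumes "1 \<le> k" "k < m" and s: "2 * real m / (real m + 1) \<le> s"
  shows "real (m choose k) powr (1 - s) \<le> 4 / (m choose k)"
proof -
  let ?C = "real (m choose k)"
  have C: "?C \<ge> 1" using assms by (simp add: Suc_le_eq)
  have "?C powr (1 - s) \<le> ?C powr (2 / (real m + 1) - 1)"
    using C s by (intro powr_mono) (auto simp: field_simps)
  also have "\<dots> = ?C powr (2 / (real m + 1)) / ?C" using C by (simp add: powr_diff)
  also have "?C powr (2 / (real m + 1)) \<le> (2 powr (real m + 1)) powr (2 / (real m + 1))"
  proof (intro powr_mono2)
    have "m choose k \<le> 2 ^ m" by (rule binomial_le_pow2)
    then have "?C \<le> 2 ^ m" by (metis of_nat_le_iff of_nat_numeral of_nat_power)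
    also have "\<dots> \<le> 2 powr (real m + 1)" by (simp add: powr_add powr_realpow)
    finally show "?C \<le> 2 powr (real m + 1)" .
  qed auto
  also have "\<dots> = 4"
  proof -
    have "(real m + 1) * (2 / (real m + 1)) = 2"
      by (subst times_divide_eq_right, rule nonzero_mult_div_cancel_left) linarith
    then show ?thesis by (simp only: powr_powr) simp
  qed
  finally show ?thesis using C by (simp add: divide_right_mono)
qed

text \<open>64 bounds \<open>8 powr s\<close>; 16 is the 4 of \<open>choose_powr_le\<close> times
  the 4 of \<open>sum_inverse_choose_le\<close>; the last summand belongs to the tuples that avoid
  \<open>j\<close>.\<close>

definition stability_const :: real where "stability_const = 64 * (16 * (1 + off_diag_const)\<^sup>2 + off_diag_const)"

lemma stability_const_ge: "stability_const \<ge> 64 * off_diag_const" "stability_const \<ge> 1"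
proof -
  show "stability_const \<ge> 64 * off_diag_const" by (simp add: stability_const_def)
  then show "stability_const \<ge> 1" using off_diag_const_ge_1 by simp
qed

text \<open>Tuples are grouped by the number \<open>k\<close> of entries other than
  \<open>j\<close>. For \<open>0 < k < m\<close> group \<open>k\<close> is of order
  \<open>\<delta>\<close> over \<open>m choose k\<close>, because the coefficient form contains that
  binomial factor and \<open>s\<close> is close to 2. Summing the inverse binomials gives the factor
  \<open>1 / m\<close>.\<close>

lemma off_diag_stability_pos:
  fixes c :: "'a list \<Rightarrow> complex"
  assumes fin: "finite J" and j: "j \<notin> J" and sym: "symm_on m (insert j J) c"
    and m: "m \<ge> 1" and p: "p \<ge> 2 * real m" and M: "lp_bound p m (insert j J) c 1"
    and \<delta>: "0 < \<delta>" "\<delta> \<le> 1 / 2" "1 - \<delta> \<le> norm (c (replicate m j))"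
  shows "(\<Sum>xs\<in>tup m (insert j J). if off_diag xs then norm (c xs) powr hl_exp m p else 0) \<le> stability_const / m * \<delta>"
proof -
  define s where "s = hl_exp m p"
  define K where "K = 1 + off_diag_const"
  define e where "e k l = of_nat (m choose k) * c (replicate (m - k) j @ l)" for k l
  define N where "N k = 8 * \<delta> powr (1 - real k / p)" for k
  define F where "F xs = (if off_diag xs then norm (c xs) powr s else 0)" for xs
  define S where "S k = (\<Sum>l\<in>tup k J. F (replicate (m - k) j @ l))" for k
  have p0: "p > 0" using p m by simp
  have s: "1 \<le> s" "s \<le> 2" "2 * real m / (real m + 1) \<le> s" "s > 0"
    unfolding s_def by (rule hl_exp_bounds[OF m p])+
  have K: "K \<ge> 1" using off_diag_const_ge_1 by (simp add: K_def)
  have N: "N k > 0" for k using \<delta> by (simp add: N_def)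
  have Ns: "N k powr s \<le> 64 * \<delta>" if k: "k \<le> m" for k
  proof -
    \<comment> \<open>This is \<open>s \<ge> p / (p - m)\<close>; it ensures that
      \<open>\<delta>\<close> enters \<open>N k powr s\<close> with an exponent of at least
      1.\<close>
    have "1 / s \<le> 1 - real m / p"
    proof -
      have "p / (p - m) \<le> s" "p - m > 0" using hl_exp_ge[OF m p] p m by (auto simp: s_def)
      then have "1 / s \<le> 1 / (p / (p - m))"
        using p0 s by (intro divide_left_mono mult_pos_pos divide_pos_pos) auto
      then show ?thesis using p0 by (simp add: diff_divide_distrib)
    qed
    also have "\<dots> \<le> 1 - real k / p" using k p0 by (simp add: divide_right_mono)
    finally have "1 \<le> (1 - real k / p) * s" using s by (simp add: field_simps)
    then have "\<delta> powr ((1 - real k / p) * s) \<le> \<delta> powr 1" using \<delta> by (intro powr_mono') auto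
    moreover have "8 powr s \<le> (8::real) powr 2" using s by (intro powr_mono) auto
    ultimately have "8 powr s * \<delta> powr ((1 - real k / p) * s) \<le> 64 * \<delta>"
      using \<delta> by (intro mult_mono) auto
    then show ?thesis using \<delta> by (simp add: N_def powr_mult powr_powr)
  qed
  have bound: "lp_bound p k J (e k) (N k)" if "1 \<le> k" "k \<le> m" for k
    unfolding e_def N_def by (rule lp_bound_coeff[OF fin j sym that p M \<delta>])
  have syme: "symm_on k J (e k)" if "k \<le> m" for k
    unfolding e_def
    using symm_on_replicate_append[OF sym, of j J "m - k"] that
    by (intro symm_on_cmult) auto
  have Sk: "real (m choose k) * S k \<le> 64 * 4 * K\<^sup>2 / (m choose k) * \<delta>" if k: "1 \<le> k" "k < m" for k
  proof -
    let ?C = "real (m choose k)"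
    have C: "?C > 0" using k by simp
    have pk: "p \<ge> 2 * real k" using p k by simp
    note b = hl_exp_bounds[OF k(1) pk]
    have "S k \<le> (\<Sum>l\<in>tup k J. norm (e k l) powr s / ?C powr s)"
      unfolding S_def
    proof (rule sum_mono)
      fix l
      have "norm (e k l) powr s / ?C powr s = norm (c (replicate (m - k) j @ l)) powr s"
        using C by (simp add: e_def norm_mult powr_mult)
      then show "F (replicate (m - k) j @ l) \<le> norm (e k l) powr s / ?C powr s"
        by (simp add: F_def)
    qed
    also have "\<dots> = (\<Sum>l\<in>tup k J. norm (e k l) powr s) / ?C powr s"
      by (rule sum_divide_distrib[symmetric])
    also have "(\<Sum>l\<in>tup k J. norm (e k l) powr s) \<le> K\<^sup>2 * N k powr s"
    proof (rule sum_powr_exp_mono)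
      have "off_diag_const / k \<le> off_diag_const / 1" using k off_diag_const_ge_1 by (intro divide_left_mono) auto
      then have "(1 + off_diag_const / k) * N k powr hl_exp k p \<le> K * N k powr hl_exp k p"
        by (intro mult_right_mono) (auto simp: K_def)
      then show "(\<Sum>l\<in>tup k J. norm (e k l) powr hl_exp k p) \<le> K * N k powr hl_exp k p"
        using sum_powr_le[OF fin syme k(1) pk bound] k by simp
    qed (use fin b s K N k p in \<open>auto simp: s_def intro!: hl_exp_mono\<close>)
    also have "\<dots> \<le> K\<^sup>2 * (64 * \<delta>)" using Ns[of k] k by (intro mult_left_mono) auto
    finally have "S k \<le> K\<^sup>2 * (64 * \<delta>) / ?C powr s" by (simp add: divide_right_mono)
    then have "?C * S k \<le> ?C * (K\<^sup>2 * (64 * \<delta>) / ?C powr s)"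
      using C by (intro mult_left_mono) auto
    also have "\<dots> = K\<^sup>2 * (64 * \<delta>) * ?C powr (1 - s)" using C by (simp add: powr_diff)
    also have "\<dots> \<le> K\<^sup>2 * (64 * \<delta>) * (4 / ?C)"
      using k s \<delta> by (intro mult_left_mono choose_powr_le) auto
    finally show ?thesis by (simp add: mult_ac)
  qed
  \<comment> \<open>Here the binomial coefficient is 1 and gives no decay; the factor
    \<open>1 / m\<close> comes from the off-diagonal bound for the restriction to
    \<open>J\<close>.\<close>
  have Sm: "S m \<le> 64 * off_diag_const / m * \<delta>"
  proof -
    have "S m \<le> off_diag_const / m * N m powr s"
    proof -
      have em: "e m = c" by (simp add: e_def fun_eq_iff)
      show ?thesis using off_diag_le[OF fin syme[of m] m p bound[of m]] m unfolding em S_def F_def s_def diff_self_eq_0 replicate_0 append_Nil by simp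
    qed
    also have "\<dots> \<le> off_diag_const / m * (64 * \<delta>)"
      using Ns[of m] off_diag_const_ge_1 by (intro mult_left_mono) auto
    finally show ?thesis by (simp add: mult_ac)
  qed
  have S0: "S 0 = 0" by (auto simp: S_def F_def off_diag_def)
  have "symm_on m (insert j J) F"
    unfolding symm_on_def
  proof (intro ballI allI impI)
    fix xs ys assume xs: "xs \<in> tup m (insert j J)" "mset xs = mset ys"
    then have "set xs = set ys" by (metis set_mset_mset)
    moreover have "c xs = c ys" by (rule symm_onD[OF sym xs])
    ultimately show "F xs = F ys" by (simp add: F_def off_diag_def)
  qed
  then have "(\<Sum>xs\<in>tup m (insert j J). F xs) =
      (\<Sum>t\<le>m. real (m choose t) * (\<Sum>l\<in>tup (m - t) J. F (replicate t j @ l)))"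
    by (rule sum_tup_split[OF fin j])
  also have "\<dots> = (\<Sum>k\<le>m. real (m choose k) * S k)"
    by (rule sum.reindex_bij_witness[of _ "\<lambda>t. m - t" "\<lambda>t. m - t"]) (auto simp: S_def binomial_symmetric[symmetric])
  also have "{..m} = insert 0 (insert m {1..<m})" using m by auto
  also have "(\<Sum>k\<in>insert 0 (insert m {1..<m}). real (m choose k) * S k) = S m + (\<Sum>k=1..<m. real (m choose k) * S k)"
    using m S0 by simp
  finally have F: "(\<Sum>xs\<in>tup m (insert j J). F xs) = S m + (\<Sum>k=1..<m. real (m choose k) * S k)" .
  have "(\<Sum>k=1..<m. real (m choose k) * S k) \<le> (\<Sum>k=1..<m. 64 * 4 * K\<^sup>2 * \<delta> * (1 / (m choose k)))"
    using Sk by (intro sum_mono) (auto simp: mult_ac)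
  also have "\<dots> \<le> 64 * 4 * K\<^sup>2 * \<delta> * (4 / m)"
    unfolding sum_distrib_left[symmetric] using \<delta> by (intro mult_left_mono sum_inverse_choose_le) auto
  finally have "(\<Sum>xs\<in>tup m (insert j J). F xs) \<le> 64 * off_diag_const / m * \<delta> + 64 * 4 * K\<^sup>2 * \<delta> * (4 / m)"
    unfolding F using Sm by linarith
  also have "\<dots> = stability_const / m * \<delta>"
    by (simp add: stability_const_def K_def add_divide_distrib algebra_simps)
  finally show ?thesis unfolding F_def s_def .
qed

text \<open>A limit argument includes a diagonal entry of modulus 1, for which the deficit is 0. If
  the deficit is at least 1/2, the general off-diagonal bound is already enough.\<close>

lemma off_diag_stability:
  fixes c :: "'a list \<Rightarrow> complex"
  assumes fin: "finite I" and j: "j \<in> I" and sym: "symm_on m I c"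
    and m: "m \<ge> 1" and p: "p \<ge> 2 * real m" and M: "lp_bound p m I c 1"
  shows "(\<Sum>xs\<in>tup m I. if off_diag xs then norm (c xs) powr hl_exp m p else 0)
    \<le> stability_const / m * (1 - norm (c (replicate m j)))" (is "?L \<le> stability_const / m * ?\<delta>")
proof (cases "?\<delta> < 1 / 2")
  case True
  have I: "insert j (I - {j}) = I" using j by auto
  have \<delta>0: "?\<delta> \<ge> 0" using norm_diag_le[OF fin sym m p M j] by simp
  show ?thesis
  proof (rule field_le_epsilon)
    fix \<epsilon> :: real assume \<epsilon>: "\<epsilon> > 0"
    \<comment> \<open>A positive value at most 1/2 whose excess over the true deficit contributes at
      most \<open>\<epsilon>\<close> after multiplication by
      \<open>stability_const / m\<close>.\<close>
    define \<delta> where "\<delta> = min (1 / 2) (?\<delta> + \<epsilon> * m / stability_const)"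
    have e: "\<epsilon> * m / stability_const > 0" using \<epsilon> m stability_const_ge by simp
    have \<delta>: "0 < \<delta>" "\<delta> \<le> 1 / 2" "1 - \<delta> \<le> norm (c (replicate m j))"
      using True \<delta>0 e by (auto simp: \<delta>_def min_def)
    have "?L \<le> stability_const / m * \<delta>"
      using off_diag_stability_pos[of "I - {j}" j m c p \<delta>, unfolded I, OF _ _ sym m p M \<delta>] fin by simp
    also have "\<dots> \<le> stability_const / m * (?\<delta> + \<epsilon> * m / stability_const)"
      using stability_const_ge by (intro mult_left_mono) (auto simp: \<delta>_def)
    also have "\<dots> = stability_const / m * ?\<delta> + \<epsilon>" using m stability_const_ge by (simp add: distrib_left)
    finally show "?L \<le> stability_const / m * ?\<delta> + \<epsilon>" .
  qed
next
  case False
  have "?L \<le> off_diag_const / m" using off_diag_le[OF fin sym m p M] by simp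
  also have "\<dots> \<le> stability_const * (1 / 2) / m" using stability_const_ge off_diag_const_ge_1 by (intro divide_right_mono) auto
  also have "\<dots> = stability_const / m * (1 / 2)" by simp
  also have "\<dots> \<le> stability_const / m * ?\<delta>" using False stability_const_ge by (intro mult_left_mono) auto
  finally show ?thesis .
qed

section \<open>The contractive inequality for large degree\<close>

lemma hl_exp_gap:
  assumes m: "m \<ge> 2" and A: "0 < A" "A \<le> real m" and p: "p \<ge> 2 * real m + A"
  shows "A / (6 * m) \<le> hl_exp m p - p / (p - m)"
proof -
  have p2: "p \<ge> 2 * real m" and p0: "p > 0" "p - m > 0" using p A m by auto
  have "p \<le> real m * p" using m p0 by simp
  then have D: "real m * p + p - 2 * real m > 0" using p2 p0 m by linarith
  have "A / (6 * m) = 1 / 3 * (A / (2 * m))" by simp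
  \<comment> \<open>Of the two factors of \<open>hl_exp_minus\<close>, the first is at least 1/3
    once \<open>m \<ge> 2\<close>. The second is at least \<open>A / (m + A)\<close>, its value at
    \<open>p = 2m + A\<close>, hence at least \<open>A / (2 * m)\<close> as
    \<open>A \<le> m\<close>.\<close>
  also have "\<dots> \<le> p * (real m - 1) / (real m * p + p - 2 * real m) * ((p - 2 * real m) / (p - m))"
  proof (rule mult_mono)
    have "real m * p + p - 2 * real m \<le> 3 * (p * (real m - 1))"
    proof -
      have "0 \<le> 2 * (p * (real m - 2)) + 2 * real m" using m p0 by simp
      then show ?thesis by (simp add: algebra_simps)
    qed
    then show "1 / 3 \<le> p * (real m - 1) / (real m * p + p - 2 * real m)"
      using D by (simp add: field_simps)
    have "A * (p - m) \<le> (p - 2 * real m) * (2 * m)"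
    proof -
      have "A * (p - 2 * real m) \<le> real m * (p - 2 * real m)" using A p2 by (intro mult_right_mono) auto
      moreover have "A * real m \<le> (p - 2 * real m) * real m" using p by (intro mult_right_mono) auto
      ultimately show ?thesis by (simp add: algebra_simps)
    qed
    then show "A / (2 * m) \<le> (p - 2 * real m) / (p - m)"
      using p0 m by (simp add: field_simps)
  qed (use m A D p0 in auto)
  also have "\<dots> = hl_exp m p - p / (p - m)" using m p2 by (subst hl_exp_minus) auto
  finally show ?thesis .
qed

lemma powr_le_bernoulli:
  assumes "0 \<le> x" "x \<le> (1::real)" "0 \<le> a" "a \<le> 1"
  shows "x powr a \<le> 1 - a * (1 - x)"
proof (cases "x = 0")
  case True
  then show ?thesis using assms by simp
next
  case False
  then show ?thesis
    using Youngs_inequality_0[of a "1 - a" x 1] assms by (simp add: algebra_simps)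
qed

text \<open>With the deficit measured at the largest diagonal entry, the diagonal loses at least
  \<open>stability_const / m\<close> times it and the off-diagonal part gains at most the same
  amount.\<close>

lemma sum_powr_le_1:
  fixes c :: "'a list \<Rightarrow> complex"
  assumes fin: "finite I" and ne: "I \<noteq> {}" and sym: "symm_on m I c"
    and m: "m \<ge> 2" "6 * stability_const \<le> real m" and p: "p \<ge> 2 * real m + 6 * stability_const" and M: "lp_bound p m I c 1"
  shows "(\<Sum>xs\<in>tup m I. norm (c xs) powr hl_exp m p) \<le> 1"
proof -
  have m1: "m \<ge> 1" and p2: "p \<ge> 2 * real m" using m p stability_const_ge by auto
  define a where "a = hl_exp m p - p / (p - m)"
  obtain j where j: "j \<in> I" "\<And>k. k \<in> I \<Longrightarrow> norm (c (replicate m k)) \<le> norm (c (replicate m j))"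
  proof -
    let ?f = "\<lambda>k. norm (c (replicate m k))"
    have "Max (?f ` I) \<in> ?f ` I" using fin ne by (intro Max_in) auto
    then obtain j where "Max (?f ` I) = ?f j" "j \<in> I" by (rule imageE)
    moreover have "?f k \<le> Max (?f ` I)" if "k \<in> I" for k using fin that by (intro Max_ge) auto
    ultimately show ?thesis using that[of j] by simp
  qed
  let ?\<kappa> = "norm (c (replicate m j))"
  have \<kappa>: "?\<kappa> \<le> 1" by (rule norm_diag_le[OF fin sym m1 p2 M j(1)])
  \<comment> \<open>The choice \<open>A = 6 * stability_const\<close> compensates the 6 in
    \<open>hl_exp_gap\<close>.\<close>
  have "stability_const / m = 6 * stability_const / (6 * m)" by simp
  also have "\<dots> \<le> a" unfolding a_def by (rule hl_exp_gap) (use m p stability_const_ge in auto)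
  finally have a: "stability_const / m \<le> a" .
  have "a \<ge> 0" "a \<le> 1" using hl_exp_ge[OF m1 p2] hl_exp_bounds[OF m1 p2] by (auto simp: a_def)
  then have "?\<kappa> powr a \<le> 1 - a * (1 - ?\<kappa>)" using \<kappa> by (intro powr_le_bernoulli) auto
  also have "\<dots> \<le> 1 - stability_const / m * (1 - ?\<kappa>)" using mult_right_mono[OF a, of "1 - ?\<kappa>"] \<kappa> by simp
  finally have "(\<Sum>k\<in>I. norm (c (replicate m k)) powr hl_exp m p) \<le> 1 - stability_const / m * (1 - ?\<kappa>)"
    using diag_powr_le[OF fin sym m1 p2 M j(2)] by (simp add: a_def)
  then show ?thesis
    using off_diag_stability[OF fin j(1) sym m1 p2 M]
    by (subst sum_off_diag_split[OF fin m1]) linarith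
qed

lemma lp_bound_scale:
  assumes "lp_bound p m I c M" "M > 0"
  shows "lp_bound p m I (\<lambda>xs. of_real (1 / M) * c xs) 1"
  unfolding lp_bound_def form_val_cmult
proof (intro allI impI)
  fix z :: "'a \<Rightarrow> complex" assume "(\<Sum>i\<in>I. norm (z i) powr p) \<le> 1"
  then have "norm (form_val m I c z) \<le> M" using assms(1) by (simp add: lp_bound_def)
  then show "norm (of_real (1 / M) * form_val m I c z) \<le> 1"
    using assms(2) by (simp add: norm_divide divide_le_eq)
qed

text \<open>Homogeneity reduces to the bound 1; working with \<open>M + \<epsilon>\<close> avoids
  dividing by \<open>M = 0\<close>.\<close>

lemma hl_norm_le_1:
  fixes c :: "'a list \<Rightarrow> complex"
  assumes fin: "finite I" and ne: "I \<noteq> {}" and sym: "symm_on m I c"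
    and m: "m \<ge> 2" "6 * stability_const \<le> real m" and p: "p \<ge> 2 * real m + 6 * stability_const" and M: "lp_bound p m I c M"
  shows "(\<Sum>xs\<in>tup m I. norm (c xs) powr hl_exp m p) powr (1 / hl_exp m p) \<le> M"
proof -
  have m1: "m \<ge> 1" and p2: "p \<ge> 2 * real m" and p0: "p > 0" using m p stability_const_ge by auto
  have s: "hl_exp m p > 0" by (rule hl_exp_bounds[OF m1 p2])
  have pos: "(\<Sum>xs\<in>tup m I. norm (c xs) powr hl_exp m p) powr (1 / hl_exp m p) \<le> M'"
    if M': "M' > 0" "lp_bound p m I c M'" for M'
  proof -
    have "(\<Sum>xs\<in>tup m I. norm (of_real (1 / M') * c xs) powr hl_exp m p) \<le> 1"
      by (rule sum_powr_le_1[OF fin ne symm_on_cmult[OF sym] m p lp_bound_scale[OF M'(2,1)]])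
    also have "(\<Sum>xs\<in>tup m I. norm (of_real (1 / M') * c xs) powr hl_exp m p) =
        (\<Sum>xs\<in>tup m I. norm (c xs) powr hl_exp m p / M' powr hl_exp m p)"
      using M'(1) by (intro sum.cong refl) (simp add: norm_divide powr_divide)
    also have "\<dots> = (\<Sum>xs\<in>tup m I. norm (c xs) powr hl_exp m p) / M' powr hl_exp m p"
      by (rule sum_divide_distrib[symmetric])
    finally have "(\<Sum>xs\<in>tup m I. norm (c xs) powr hl_exp m p) \<le> M' powr hl_exp m p"
      using M'(1) by (simp add: divide_le_eq)
    then have "(\<Sum>xs\<in>tup m I. norm (c xs) powr hl_exp m p) powr (1 / hl_exp m p) \<le> (M' powr hl_exp m p) powr (1 / hl_exp m p)"
      using s by (intro powr_mono2) (auto intro!: sum_nonneg)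
    then show ?thesis using s M'(1) by (simp add: powr_powr)
  qed
  have M0: "M \<ge> 0" by (rule lp_bound_nonneg[OF M p0])
  show ?thesis
  proof (rule field_le_epsilon)
    fix \<epsilon> :: real assume "\<epsilon> > 0"
    then show "(\<Sum>xs\<in>tup m I. norm (c xs) powr hl_exp m p) powr (1 / hl_exp m p) \<le> M + \<epsilon>"
      using M0 by (intro pos lp_bound_mono[OF M]) auto
  qed
qed

lemma hl_norm_le:
  fixes c :: "'a list \<Rightarrow> complex"
  assumes fin: "finite I" and sym: "symm_on m I c" and m: "m \<ge> 1" and p: "p \<ge> 2 * real m"
    and M: "lp_bound p m I c M"
  shows "(\<Sum>xs\<in>tup m I. norm (c xs) powr hl_exp m p) powr (1 / hl_exp m p) \<le> (1 + off_diag_const / m) * M"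
proof -
  have p0: "p > 0" using m p by auto
  note s = hl_exp_bounds[OF m p]
  have M0: "M \<ge> 0" by (rule lp_bound_nonneg[OF M p0])
  have K: "1 + off_diag_const / m \<ge> 1" using off_diag_const_ge_1 by simp
  have "(\<Sum>xs\<in>tup m I. norm (c xs) powr hl_exp m p) powr (1 / hl_exp m p)
      \<le> ((1 + off_diag_const / m) * M powr hl_exp m p) powr (1 / hl_exp m p)"
    using s sum_powr_le[OF fin sym m p M] by (intro powr_mono2) (auto intro!: sum_nonneg)
  also have "\<dots> = (1 + off_diag_const / m) powr (1 / hl_exp m p) * M"
    using K M0 s by (simp add: powr_mult powr_powr)
  \<comment> \<open>The exponent \<open>1 / s\<close> is at most 1 and the base at least 1, so
    taking the root does not enlarge the factor.\<close>
  also have "\<dots> \<le> (1 + off_diag_const / m) powr 1 * M"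
    using K M0 s by (intro mult_right_mono powr_mono) auto
  also have "(1 + off_diag_const / m) powr 1 = 1 + off_diag_const / m" using K by simp
  finally show ?thesis .
qed

section \<open>Multilinear forms\<close>

lemma multilinear_sum:
  assumes T: "multilinear_form m n T" and vs: "vs \<in> vec_tuples m n" and k: "k < m" and z: "z \<in> carrier_vec n"
  shows "T (vs[k := z]) = (\<Sum>i<n. vec_index z i * T (vs[k := unit_vec n i]))"
proof -
  have add: "T (vs[k := u + w]) = T (vs[k := u]) + T (vs[k := w])"
    if "u \<in> carrier_vec n" "w \<in> carrier_vec n" for u w
    using T vs k that unfolding multilinear_form_def by blast
  have smult: "T (vs[k := a \<cdot>\<^sub>v u]) = a * T (vs[k := u])" if "u \<in> carrier_vec n" for a u
    using T vs k that unfolding multilinear_form_def by blast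
  \<comment> \<open>Induction on truncations of \<open>z\<close>, which gain one coordinate at a
    time.\<close>
  have "T (vs[k := Matrix.vec n (\<lambda>i. if i < r then vec_index z i else 0)]) =
      (\<Sum>i<r. vec_index z i * T (vs[k := unit_vec n i]))" if "r \<le> n" for r
    using that
  proof (induction r)
    case 0
    have "Matrix.vec n (\<lambda>i. if i < 0 then vec_index z i else 0) = 0 \<cdot>\<^sub>v z"
      using z by (intro eq_vecI) auto
    then show ?case using smult[OF z, of 0] by simp
  next
    case (Suc r)
    have "Matrix.vec n (\<lambda>i. if i < Suc r then vec_index z i else 0) =
        Matrix.vec n (\<lambda>i. if i < r then vec_index z i else 0) + vec_index z r \<cdot>\<^sub>v unit_vec n r"
      using Suc.prems by (intro eq_vecI) (auto simp: less_Suc_eq)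
    then show ?case using Suc add smult by simp
  qed
  from this[of n] have "T (vs[k := Matrix.vec n (\<lambda>i. if i < n then vec_index z i else 0)]) =
      (\<Sum>i<n. vec_index z i * T (vs[k := unit_vec n i]))" by simp
  moreover have "Matrix.vec n (\<lambda>i. if i < n then vec_index z i else 0) = z"
    using z by (intro eq_vecI) auto
  ultimately show ?thesis by simp
qed

text \<open>The prefix \<open>us\<close> holds the slots already treated; the induction replaces the
  leftmost remaining copy of \<open>z\<close> by basis vectors.\<close>

lemma multilinear_expand:
  assumes T: "multilinear_form m n T" and z: "z \<in> carrier_vec n"
    and us: "set us \<subseteq> carrier_vec n" "length us + k = m"
  shows "T (us @ replicate k z) = (\<Sum>is\<in>tup k {..<n}. mprod (vec_index z) is * T (us @ map (unit_vec n) is))"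
  using us
proof (induction k arbitrary: us)
  case (Suc k)
  let ?vs = "us @ replicate (Suc k) z"
  have vs: "?vs \<in> vec_tuples m n" using Suc.prems z by (auto simp: vec_tuples_def)
  have upd: "?vs[length us := w] = (us @ [w]) @ replicate k z" for w by simp
  have "T ?vs = T (?vs[length us := z])" unfolding upd by simp
  also have "\<dots> = (\<Sum>i<n. vec_index z i * T (?vs[length us := unit_vec n i]))"
    using Suc.prems by (intro multilinear_sum[OF T vs _ z]) auto
  also have "\<dots> = (\<Sum>i<n. vec_index z i * T ((us @ [unit_vec n i]) @ replicate k z))"
    by (simp only: upd)
  also have "\<dots> = (\<Sum>i<n. vec_index z i * (\<Sum>is\<in>tup k {..<n}. mprod (vec_index z) is * T ((us @ [unit_vec n i]) @ map (unit_vec n) is)))"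
    using Suc.prems by (subst Suc.IH) auto
  also have "\<dots> = (\<Sum>is\<in>tup (Suc k) {..<n}. mprod (vec_index z) is * T (us @ map (unit_vec n) is))"
    by (simp add: sum_tup_Suc sum_distrib_left mult_ac)
  finally show ?case .
qed simp

lemma symm_on_symmetric_form:
  assumes "symmetric_form m n T"
  shows "symm_on m {..<n} (\<lambda>is. T (map (unit_vec n) is))"
  unfolding symm_on_def
proof (intro ballI allI impI)
  fix xs ys :: "nat list" assume xs: "xs \<in> tup m {..<n}" "mset xs = mset ys"
  obtain \<sigma> where \<sigma>: "\<sigma> permutes {..<length xs}" "permute_list \<sigma> xs = ys"
    using mset_eq_permutation[of ys xs] xs by metis
  have "map (unit_vec n) xs \<in> vec_tuples m n" using xs by (auto simp: tup_def vec_tuples_def)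
  moreover have "length xs = m" using xs by (simp add: tup_def)
  ultimately have "T (permute_list \<sigma> (map (unit_vec n) xs)) = T (map (unit_vec n) xs)"
    using assms \<sigma> unfolding symmetric_form_def by blast
  then show "T (map (unit_vec n) xs) = T (map (unit_vec n) ys)"
    by (simp add: permute_list_map[OF \<sigma>(1)] \<sigma>(2))
qed

lemma lp_bound_diag_sup:
  assumes T: "multilinear_form m n T" and p: "p > 0"
  shows "lp_bound p m {..<n} (\<lambda>is. T (map (unit_vec n) is)) (diag_sup m n p T)"
  unfolding lp_bound_def
proof (intro allI impI)
  let ?c = "\<lambda>is. T (map (unit_vec n) is)"
  let ?B = "{z \<in> carrier_vec n. lp_norm p z \<le> 1}"
  have rep: "T (replicate m z) = form_val m {..<n} ?c (vec_index z)" if "z \<in> carrier_vec n" for z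
    using multilinear_expand[OF T that, of "[]" m] by (simp add: form_val_def mult.commute)
  \<comment> \<open>Boundedness makes the real supremum an upper bound: on the ball all coordinates
    have modulus at most 1, so the sum of the coefficient moduli dominates.\<close>
  have bdd: "bdd_above ((\<lambda>z. cmod (T (replicate m z))) ` ?B)"
  proof (rule bdd_aboveI2)
    fix z assume z: "z \<in> ?B"
    have zi: "cmod (vec_index z i) \<le> 1" if "i < n" for i
    proof (rule ccontr)
      assume "\<not> ?thesis"
      then have "1 < cmod (vec_index z i) powr p" using p by (simp add: gr_one_powr)
      also have "\<dots> \<le> (\<Sum>i < dim_vec z. cmod (vec_index z i) powr p)"
        using z that by (intro member_le_sum) auto
      finally have "1 < lp_norm p z" unfolding lp_norm_def using p by (intro gr_one_powr) auto
      then show False using z by simp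
    qed
    have "cmod (T (replicate m z)) \<le> (\<Sum>is\<in>tup m {..<n}. cmod (?c is * mprod (vec_index z) is))"
      using z rep[of z] by (simp add: form_val_def norm_sum)
    also have "\<dots> \<le> (\<Sum>is\<in>tup m {..<n}. cmod (?c is))"
    proof (rule sum_mono)
      fix "is" assume i: "is \<in> tup m {..<n}"
      have "mprod (\<lambda>i. cmod (vec_index z i)) l \<le> 1" if "set l \<subseteq> {..<n}" for l
        using that by (induction l) (auto intro!: mult_le_one zi mprod_nonneg)
      then have "cmod (mprod (vec_index z) is) \<le> 1" using i by (simp add: norm_mprod tup_def)
      then show "cmod (?c is * mprod (vec_index z) is) \<le> cmod (?c is)"
        by (simp add: norm_mult mult_left_le)
    qed
    finally show "cmod (T (replicate m z)) \<le> (\<Sum>is\<in>tup m {..<n}. cmod (?c is))" .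
  qed
  fix z :: "nat \<Rightarrow> complex" assume z: "(\<Sum>i<n. cmod (z i) powr p) \<le> 1"
  let ?z = "Matrix.vec n z"
  have "lp_norm p ?z \<le> 1 powr (1 / p)"
    unfolding lp_norm_def using z p by (intro powr_mono2) (auto intro!: sum_nonneg)
  then have "?z \<in> ?B" by simp
  then have "cmod (T (replicate m ?z)) \<le> diag_sup m n p T"
    unfolding diag_sup_def using bdd by (intro cSUP_upper)
  also have "T (replicate m ?z) = form_val m {..<n} ?c (vec_index ?z)" by (rule rep) simp
  also have "\<dots> = form_val m {..<n} ?c z" by (rule form_val_cong) simp
  finally show "cmod (form_val m {..<n} ?c z) \<le> diag_sup m n p T" .
qed

lemma index_tuples_eq_tup: "index_tuples m n = tup m {..<n}"
  by (simp add: index_tuples_def tup_def)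

theorem corollary1p1:
  shows "(\<exists>C::real. C > 0 \<and>
           (\<forall>m::nat. \<forall>n::nat. \<forall>p::real. \<forall>T :: complex Matrix.vec list \<Rightarrow> complex.
              m \<ge> 1 \<longrightarrow> n \<ge> 1 \<longrightarrow> p \<ge> 2 * real m \<longrightarrow>
              multilinear_form m n T \<longrightarrow> symmetric_form m n T \<longrightarrow>
              (\<Sum>is \<in> index_tuples m n. cmod (T (map (unit_vec n) is))
                   powr (2 * real m * p / (real m * p + p - 2 * real m)))
                 powr ((real m * p + p - 2 * real m) / (2 * real m * p))
              \<le> (1 + C / real m) * diag_sup m n p T)) \<and>
         (\<exists>A::real. \<exists>m0::nat. A > 0 \<and> m0 \<ge> 1 \<and>
           (\<forall>m::nat. \<forall>n::nat. \<forall>p::real. \<forall>T :: complex Matrix.vec list \<Rightarrow> complex.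
              m \<ge> m0 \<longrightarrow> n \<ge> 1 \<longrightarrow> p \<ge> 2 * real m + A \<longrightarrow>
              multilinear_form m n T \<longrightarrow> symmetric_form m n T \<longrightarrow>
              (\<Sum>is \<in> index_tuples m n. cmod (T (map (unit_vec n) is))
                   powr (2 * real m * p / (real m * p + p - 2 * real m)))
                 powr ((real m * p + p - 2 * real m) / (2 * real m * p))
              \<le> diag_sup m n p T))"
proof -
  have s: "2 * real m * p / (real m * p + p - 2 * real m) = hl_exp m p"
    "(real m * p + p - 2 * real m) / (2 * real m * p) = 1 / hl_exp m p" for m p
    by (simp_all add: hl_exp_def)
  show ?thesis
    unfolding s index_tuples_eq_tup
  proof (intro conjI)
    show "\<exists>C::real. C > 0 \<and> (\<forall>m n p. \<forall>T :: complex Matrix.vec list \<Rightarrow> complex.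
        m \<ge> 1 \<longrightarrow> n \<ge> 1 \<longrightarrow> p \<ge> 2 * real m \<longrightarrow> multilinear_form m n T \<longrightarrow> symmetric_form m n T \<longrightarrow>
        (\<Sum>is\<in>tup m {..<n}. cmod (T (map (unit_vec n) is)) powr hl_exp m p) powr (1 / hl_exp m p)
          \<le> (1 + C / real m) * diag_sup m n p T)"
    proof (rule exI[of _ off_diag_const], rule conjI)
      show "off_diag_const > 0" using off_diag_const_ge_1 by simp
      show "\<forall>m n p. \<forall>T :: complex Matrix.vec list \<Rightarrow> complex.
        m \<ge> 1 \<longrightarrow> n \<ge> 1 \<longrightarrow> p \<ge> 2 * real m \<longrightarrow> multilinear_form m n T \<longrightarrow> symmetric_form m n T \<longrightarrow>
        (\<Sum>is\<in>tup m {..<n}. cmod (T (map (unit_vec n) is)) powr hl_exp m p) powr (1 / hl_exp m p)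
          \<le> (1 + off_diag_const / real m) * diag_sup m n p T"
      proof (intro allI impI)
        fix m n :: nat and p :: real and T :: "complex Matrix.vec list \<Rightarrow> complex"
        assume m: "1 \<le> m" and p: "2 * real m \<le> p" and T: "multilinear_form m n T" "symmetric_form m n T"
        have "p > 0" using m p by simp
        then show "(\<Sum>is\<in>tup m {..<n}. cmod (T (map (unit_vec n) is)) powr hl_exp m p) powr (1 / hl_exp m p)
          \<le> (1 + off_diag_const / real m) * diag_sup m n p T"
          by (rule hl_norm_le[OF finite_lessThan symm_on_symmetric_form[OF T(2)] m p lp_bound_diag_sup[OF T(1)]])
      qed
    qed
    show "\<exists>A::real. \<exists>m0::nat. A > 0 \<and> m0 \<ge> 1 \<and> (\<forall>m n p. \<forall>T :: complex Matrix.vec list \<Rightarrow> complex.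
        m \<ge> m0 \<longrightarrow> n \<ge> 1 \<longrightarrow> p \<ge> 2 * real m + A \<longrightarrow> multilinear_form m n T \<longrightarrow> symmetric_form m n T \<longrightarrow>
        (\<Sum>is\<in>tup m {..<n}. cmod (T (map (unit_vec n) is)) powr hl_exp m p) powr (1 / hl_exp m p)
          \<le> diag_sup m n p T)"
    \<comment> \<open>This \<open>m0\<close> secures both \<open>m \<ge> 2\<close> and
      \<open>A \<le> m\<close>, as the gap estimate demands.\<close>
    proof (rule exI[of _ "6 * stability_const"], rule exI[of _ "nat \<lceil>6 * stability_const\<rceil> + 2"], intro conjI)
      show "6 * stability_const > 0" using stability_const_ge(2) by simp
      show "1 \<le> nat \<lceil>6 * stability_const\<rceil> + 2" by simp
      show "\<forall>m n p. \<forall>T :: complex Matrix.vec list \<Rightarrow> complex.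
        m \<ge> nat \<lceil>6 * stability_const\<rceil> + 2 \<longrightarrow> n \<ge> 1 \<longrightarrow> p \<ge> 2 * real m + 6 * stability_const \<longrightarrow> multilinear_form m n T \<longrightarrow> symmetric_form m n T \<longrightarrow>
        (\<Sum>is\<in>tup m {..<n}. cmod (T (map (unit_vec n) is)) powr hl_exp m p) powr (1 / hl_exp m p)
          \<le> diag_sup m n p T"
      proof (intro allI impI)
        fix m n :: nat and p :: real and T :: "complex Matrix.vec list \<Rightarrow> complex"
        assume m: "nat \<lceil>6 * stability_const\<rceil> + 2 \<le> m" and n: "1 \<le> n" and p: "2 * real m + 6 * stability_const \<le> p"
          and T: "multilinear_form m n T" "symmetric_form m n T"
        have m2: "2 \<le> m" and spm: "6 * stability_const \<le> real m" using m by linarith+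
        have ne: "{..<n} \<noteq> {}" using n by (simp add: lessThan_empty_iff)
        have "p > 0" using p m2 stability_const_ge(2) by linarith
        then show "(\<Sum>is\<in>tup m {..<n}. cmod (T (map (unit_vec n) is)) powr hl_exp m p) powr (1 / hl_exp m p)
          \<le> diag_sup m n p T"
          by (rule hl_norm_le_1[OF finite_lessThan ne symm_on_symmetric_form[OF T(2)] m2 spm p lp_bound_diag_sup[OF T(1)]])
      qed
    qed
  qed
qed

end
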